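(* Let $r\ge 2$ and let $m_1,m_2,\dots,m_{r-1}\ge 2$ be integers. Let $F(z)$ be the rational function $$F(z)=-z+\cfrac{1}{m_1z-\cfrac{m_1-2}{z}-\cfrac{1}{m_2z-\cfrac{m_2-2}{z}-\dots-\cfrac{1}{m_{r-1}z-\cfrac{m_{r-1}-1}{z}}}},$$ that is, $F(z)=-z+1/F_1(z)$, where $F_{r-1}(z)=m_{r-1}z-\frac{m_{r-1}-1}{z}$ and $F_i(z)=m_iz-\frac{m_i-2}{z}-\frac{1}{F_{i+1}(z)}$ for $1\le i\le r-2$. Then there exists a unique (up to isomorphism of rooted trees) finite tree $T$ rooted at a pendant vertex $v_0$ such that $$\frac{\psi_T(z)}{\theta_T(z)}=F(z).$$ This tree is a caterpillar tree with stalk $v_0\to v_1\to\dots\to v_r$, rooted at $v_0$, with degrees of the vertices on the stalk $d(v_0)=d(v_r)=1$ and $d(v_i)=m_i$ for $i=1,2,\dots,r-1$.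
   Context: A caterpillar tree is a finite tree in which all vertices are within distance 1 of a central path, called the stalk; the stalk is taken to be a longest path. For a finite tree $T$ with vertices $v_0,v_1,\dots,v_{p-1}$ ($p\ge2$) rooted at a pendant (degree 1) vertex $v_0$, let $A$ be the adjacency matrix of $T$ with first row and column corresponding to $v_0$, and let $D=\mathrm{diag}(d(v_0),d(v_1),\dots,d(v_{p-1}))$, where $d(v)$ is the degree of $v$ in $T$. Let $A_1$ and $D_1$ be the principal submatrices of $A$ and $D$ obtained by deleting the first row and the first column (so $D_1$ contains the degrees in the original tree $T$). Put $$\psi_T(z)=\det(-zD+A),\qquad \theta_T(z)=\det(-zD_1+A_1).$$ *)

theory Defs
  imports
    "Graph_Theory.Graph_Theory"
    "Jordan_Normal_Form.Determinant"
    "HOL-Computational_Algebra.Fraction_Field"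
begin

text \<open>
  Finite simple graphs are the loop-free symmetric pair digraphs (\<open>pair_graph\<close>), each edge
  being the two opposite arcs.  The predicate \<open>Digraph_Component.tree\<close> is not suitable for such
  graphs, since there the back-and-forth walk \<open>u, v, u\<close> counts as a cycle; a cycle of the
  undirected graph is a cycle with at least three arcs.
\<close>

definition finite_tree :: "'a pair_pre_digraph \<Rightarrow> bool" where
  "finite_tree G \<longleftrightarrow>
     pair_graph G \<and> Digraph_Component.connected (with_proj G) \<and>
     \<not> (\<exists>c. pre_digraph.cycle (with_proj G) c \<and> 3 \<le> length c)"

abbreviation degree_of :: "'a pair_pre_digraph \<Rightarrow> 'a \<Rightarrow> nat" where
  "degree_of G v \<equiv> out_degree (with_proj G) v"

definition pendant_rooted_tree :: "'a pair_pre_digraph \<Rightarrow> 'a \<Rightarrow> bool" where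
  "pendant_rooted_tree G v\<^sub>0 \<longleftrightarrow> finite_tree G \<and> v\<^sub>0 \<in> pverts G \<and> degree_of G v\<^sub>0 = 1"

definition rooted_iso ::
    "'a pair_pre_digraph \<Rightarrow> 'a \<Rightarrow> 'b pair_pre_digraph \<Rightarrow> 'b \<Rightarrow> bool" where
  "rooted_iso G v\<^sub>0 H w\<^sub>0 \<longleftrightarrow>
     (\<exists>h. pre_digraph.digraph_isomorphism (with_proj G) h \<and>
          with_proj H = app_iso h (with_proj G) \<and> iso_verts h v\<^sub>0 = w\<^sub>0)"

definition caterpillar_with_stalk :: "'a pair_pre_digraph \<Rightarrow> 'a list \<Rightarrow> bool" where
  "caterpillar_with_stalk G s \<longleftrightarrow>
     finite_tree G \<and> vpath s (with_proj G) \<and>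
     (\<forall>q. vpath q (with_proj G) \<longrightarrow> vwalk_length q \<le> vwalk_length s) \<and>
     (\<forall>v \<in> pverts G. \<exists>u \<in> set s. v = u \<or> (u, v) \<in> parcs G)"

text \<open>
  An enumeration \<open>v\<^sub>0, \<dots>, v\<^sub>p\<^sub>-\<^sub>1\<close> of the vertices starting with the root; it fixes the
  numbering of rows and columns.
\<close>

definition vertex_order :: "'a pair_pre_digraph \<Rightarrow> 'a \<Rightarrow> 'a list \<Rightarrow> bool" where
  "vertex_order G v\<^sub>0 vs \<longleftrightarrow> distinct vs \<and> set vs = pverts G \<and> hd vs = v\<^sub>0"

definition adjacency_mat :: "'a pair_pre_digraph \<Rightarrow> 'a list \<Rightarrow> complex poly mat" where
  "adjacency_mat G vs =
     mat (length vs) (length vs) (\<lambda>(i, j). if (vs ! i, vs ! j) \<in> parcs G then 1 else 0)"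

definition degree_mat :: "'a pair_pre_digraph \<Rightarrow> 'a list \<Rightarrow> complex poly mat" where
  "degree_mat G vs = mat_diag (length vs) (\<lambda>i. of_nat (degree_of G (vs ! i)))"

text \<open>The indeterminate \<open>z\<close> is the polynomial \<open>[:0, 1:]\<close>.\<close>

definition psi :: "'a pair_pre_digraph \<Rightarrow> 'a list \<Rightarrow> complex poly" where
  "psi G vs = det ((- [:0, 1:]) \<cdot>\<^sub>m degree_mat G vs + adjacency_mat G vs)"

definition theta :: "'a pair_pre_digraph \<Rightarrow> 'a list \<Rightarrow> complex poly" where
  "theta G vs = det ((- [:0, 1:]) \<cdot>\<^sub>m mat_delete (degree_mat G vs) 0 0
                       + mat_delete (adjacency_mat G vs) 0 0)"

text \<open>Rational functions in \<open>z\<close> are elements of the fraction field of \<open>\<complex>[z]\<close>.\<close>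

type_synonym ratfun = "complex poly fract"

definition zvar :: ratfun where
  "zvar = Fraction_Field.Fract [:0, 1:] 1"

text \<open>
  \<open>cf_tail r m i\<close> is \<open>F\<^sub>i\<close>; only the values at \<open>1 \<le> i \<le> r - 1\<close> matter.  No division by zero
  occurs, as \<open>F\<^sub>i\<close> behaves like \<open>m\<^sub>i z\<close> at infinity.
\<close>

function cf_tail :: "nat \<Rightarrow> (nat \<Rightarrow> nat) \<Rightarrow> nat \<Rightarrow> ratfun" where
  "cf_tail r m i =
     (if r - 1 \<le> i then of_nat (m i) * zvar - (of_nat (m i) - 1) / zvar
      else of_nat (m i) * zvar - (of_nat (m i) - 2) / zvar - 1 / cf_tail r m (Suc i))"
  by pat_completeness auto
termination by (relation "measure (\<lambda>(r, m, i). r - i)") auto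

declare cf_tail.simps [simp del]

definition cont_frac :: "nat \<Rightarrow> (nat \<Rightarrow> nat) \<Rightarrow> ratfun" where
  "cont_frac r m = - zvar + 1 / cf_tail r m 1"

end

theory Submission
  imports Defs "HOL-Library.Nat_Bijection"
begin

text \<open>
  Let \<open>branch v = d(v) z - \<Sum> 1 / branch c\<close>, summed over the children \<open>c\<close> of \<open>v\<close>.  The vector \<open>x\<close> with
  \<open>x = 1\<close> at the root and \<open>x(c) = x(v) / branch c\<close> for a child \<open>c\<close> of \<open>v\<close> satisfies
  \<open>(-z D + A) x = - branch(root) e\<^sub>0\<close>, so Cramer's rule gives \<open>\<psi> / \<theta> = - branch(root)\<close>.
  For the caterpillar this is the continued fraction.  Conversely \<open>branch v / z\<close> has the value
  \<open>d(v)\<close> at infinity, so \<open>branch v\<close> determines \<open>d(v)\<close> and the sum of \<open>1 / d(c)\<close> over the children,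
  which here leaves room for at most one child that is not a leaf; the branch at this child has the
  next tail of the continued fraction as its quotient, and the tree is recovered level by level.
\<close>

section \<open>Values of rational functions at infinity\<close>

text \<open>The numerators in the continued fraction count leaves. An inner stalk vertex of degree
  \<open>m i\<close> has a parent, a stalk child and \<open>m i - 2\<close> leaf children, each
  contributing \<open>1 / z\<close>; at \<open>r - 1\<close> the stalk child is a leaf too, hence
  \<open>m (r - 1) - 1\<close>. The converse must exclude every other family of branches with the
  same sum of reciprocals. Values at infinity reduce this to an inequality between degrees; once all
  children but one are known to be leaves, their terms cancel exactly, so the remaining branch
  equals the next tail as a rational function and not only asymptotically. Cramer's rule yields just
  \<open>\<psi> = - branch(root) \<theta>\<close>; that \<theta> is nonzero needs its own argument.
  Recursion over children needs an orientation, which a graph does not supply, so both directions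
  work with parent functions, and every finite tree is shown to arise from one.\<close>

definition value_at_infinity :: "ratfun \<Rightarrow> complex \<Rightarrow> bool" where
  "value_at_infinity f a \<longleftrightarrow>
     (\<exists>p q n. f = Fraction_Field.Fract p q \<and> degree p \<le> n \<and> degree q \<le> n \<and>
              coeff q n \<noteq> 0 \<and> coeff p n = a * coeff q n)"

text \<open>With bounds in place of exact degrees, values multiply even if a numerator has degree
  below its bound: then both sides are 0.\<close>

lemma coeff_mult_add_bounds:
  fixes p q :: "'a::comm_semiring_1 poly"
  assumes "degree p \<le> m" "degree q \<le> n"
  shows "coeff (p * q) (m + n) = coeff p m * coeff q n"
proof (cases "degree p = m \<and> degree q = n")
  case True
  then show ?thesis by (metis coeff_mult_degree_sum)
next
  case False
  with assms have lt: "degree p < m \<or> degree q < n" by auto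
  with assms degree_mult_le[of p q] have "degree (p * q) < m + n" by linarith
  moreover have "coeff p m * coeff q n = 0"
    using lt by (auto simp: coeff_eq_0)
  ultimately show ?thesis by (simp add: coeff_eq_0)
qed

lemma value_at_infinityI:
  "f = Fraction_Field.Fract p q \<Longrightarrow> degree p \<le> n \<Longrightarrow> degree q \<le> n \<Longrightarrow> coeff q n \<noteq> 0 \<Longrightarrow>
   coeff p n = a * coeff q n \<Longrightarrow> value_at_infinity f a"
  unfolding value_at_infinity_def by blast

lemma value_at_infinity_unique:
  assumes "value_at_infinity f a" "value_at_infinity f b"
  shows "a = b"
proof -
  obtain p q n where pq: "f = Fraction_Field.Fract p q" "degree p \<le> n" "degree q \<le> n"
    "coeff q n \<noteq> 0" "coeff p n = a * coeff q n"
    using assms(1) unfolding value_at_infinity_def by blast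
  obtain p' q' n' where pq': "f = Fraction_Field.Fract p' q'" "degree p' \<le> n'" "degree q' \<le> n'"
    "coeff q' n' \<noteq> 0" "coeff p' n' = b * coeff q' n'"
    using assms(2) unfolding value_at_infinity_def by blast
  have "p * q' = p' * q"
    using pq pq' by (metis coeff_0 eq_fract(1))
  then have "coeff (p * q') (n + n') = coeff (q * p') (n + n')" by (simp add: mult.commute)
  then have "a * coeff q n * coeff q' n' = b * coeff q n * coeff q' n'"
    using pq pq' by (simp add: coeff_mult_add_bounds)
  then show ?thesis using pq pq' by simp
qed

lemma value_at_infinity_of_nat: "value_at_infinity (of_nat k) (of_nat k)"
  by (rule value_at_infinityI[of _ "of_nat k" 1 0])
    (simp_all add: of_nat_fract of_nat_poly)

lemma value_at_infinity_inverse_zvar: "value_at_infinity (1 / zvar) 0"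
  by (rule value_at_infinityI[of _ 1 "[:0, 1:]" 1])
    (simp_all add: zvar_def One_fract_def)

lemma value_at_infinity_mult:
  assumes "value_at_infinity f a" "value_at_infinity g b"
  shows "value_at_infinity (f * g) (a * b)"
proof -
  obtain p q n where pq: "f = Fraction_Field.Fract p q" "degree p \<le> n" "degree q \<le> n"
    "coeff q n \<noteq> 0" "coeff p n = a * coeff q n"
    using assms(1) unfolding value_at_infinity_def by blast
  obtain p' q' n' where pq': "g = Fraction_Field.Fract p' q'" "degree p' \<le> n'" "degree q' \<le> n'"
    "coeff q' n' \<noteq> 0" "coeff p' n' = b * coeff q' n'"
    using assms(2) unfolding value_at_infinity_def by blast
  show ?thesis
    by (rule value_at_infinityI[of _ "p * p'" "q * q'" "n + n'"])
      (use pq pq' in \<open>auto simp: coeff_mult_add_bounds intro: order_trans[OF degree_mult_le add_mono]\<close>)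
qed

lemma value_at_infinity_add:
  assumes "value_at_infinity f a" "value_at_infinity g b"
  shows "value_at_infinity (f + g) (a + b)"
proof -
  obtain p q n where pq: "f = Fraction_Field.Fract p q" "degree p \<le> n" "degree q \<le> n"
    "coeff q n \<noteq> 0" "coeff p n = a * coeff q n"
    using assms(1) unfolding value_at_infinity_def by blast
  obtain p' q' n' where pq': "g = Fraction_Field.Fract p' q'" "degree p' \<le> n'" "degree q' \<le> n'"
    "coeff q' n' \<noteq> 0" "coeff p' n' = b * coeff q' n'"
    using assms(2) unfolding value_at_infinity_def by blast
  have "q \<noteq> 0" "q' \<noteq> 0" using pq pq' by auto
  then have "f + g = Fraction_Field.Fract (p * q' + p' * q) (q * q')"
    using pq pq' by simp
  moreover have "degree (p * q' + p' * q) \<le> n + n'"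
    using pq pq' by (intro degree_add_le order_trans[OF degree_mult_le])
      (auto simp: add.commute intro: add_mono)
  moreover have "degree (q * q') \<le> n + n'"
    using pq pq' by (intro order_trans[OF degree_mult_le] add_mono)
  moreover have "coeff (p' * q) (n + n') = coeff q n * coeff p' n'"
    using coeff_mult_add_bounds[of q n p' n'] pq pq' by (simp add: mult.commute)
  moreover have "coeff (p * q') (n + n') = coeff p n * coeff q' n'"
    "coeff (q * q') (n + n') = coeff q n * coeff q' n'"
    using pq pq' by (simp_all add: coeff_mult_add_bounds)
  ultimately show ?thesis
    using pq(4,5) pq'(4,5)
    by (intro value_at_infinityI[of _ "p * q' + p' * q" "q * q'" "n + n'"])
      (simp_all add: distrib_right del: mult_fract add_fract)
qed

lemma value_at_infinity_uminus:
  assumes "value_at_infinity f a"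
  shows "value_at_infinity (- f) (- a)"
proof -
  obtain p q n where "f = Fraction_Field.Fract p q" "degree p \<le> n" "degree q \<le> n"
    "coeff q n \<noteq> 0" "coeff p n = a * coeff q n"
    using assms(1) unfolding value_at_infinity_def by blast
  then show ?thesis by (intro value_at_infinityI[of _ "- p" q n]) auto
qed

lemma value_at_infinity_diff:
  assumes "value_at_infinity f a" "value_at_infinity g b"
  shows "value_at_infinity (f - g) (a - b)"
  using value_at_infinity_add[OF assms(1) value_at_infinity_uminus[OF assms(2)]] by simp

lemma value_at_infinity_sum:
  assumes "\<And>i. i \<in> I \<Longrightarrow> value_at_infinity (f i) (a i)"
  shows "value_at_infinity (sum f I) (sum a I)"
  using assms
  by (induction I rule: infinite_finite_induct)
    (use value_at_infinity_of_nat[of 0] in \<open>auto intro: value_at_infinity_add\<close>)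

lemma value_at_infinity_inverse:
  assumes "value_at_infinity f a" "a \<noteq> 0"
  shows "value_at_infinity (1 / f) (1 / a)"
proof -
  obtain p q n where "f = Fraction_Field.Fract p q" "degree p \<le> n" "degree q \<le> n"
    "coeff q n \<noteq> 0" "coeff p n = a * coeff q n"
    using assms(1) unfolding value_at_infinity_def by blast
  then show ?thesis using assms(2)
    by (intro value_at_infinityI[of _ q p n]) (auto simp: One_fract_def)
qed

lemma value_at_infinity_zero_iff: "value_at_infinity 0 a \<longleftrightarrow> a = 0"
  using value_at_infinity_unique[of 0 a 0] value_at_infinity_of_nat[of 0] by auto

lemma zvar_nonzero: "zvar \<noteq> 0"
  by (simp add: zvar_def Zero_fract_def eq_fract)

lemma value_at_infinity_of_nat_diff: "value_at_infinity (of_nat a - of_nat b) (of_nat a - of_nat b)"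
  by (intro value_at_infinity_diff value_at_infinity_of_nat)

section \<open>Two facts on determinants\<close>

text \<open>After replacing the first column of \<open>A\<close> by \<open>A x\<close>, which does not change the determinant
  when \<open>x\<^sub>0 = 1\<close>, only one term of the Laplace expansion survives.\<close>

lemma det_eq_mult_principal_minor:
  fixes A :: "'a::field mat"
  assumes A: "A \<in> carrier_mat n n" and x: "x \<in> carrier_vec n" and n: "0 < n"
    and "x $ 0 = 1" and Ax: "A *\<^sub>v x = c \<cdot>\<^sub>v unit_vec n 0"
  shows "det A = c * det (mat_delete A 0 0)"
proof -
  let ?B = "replace_col A (A *\<^sub>v x) 0"
  have B: "?B \<in> carrier_mat n n" using A by (auto simp: replace_col_def)
  have "det A = det ?B" using cramer_lemma_mat[OF A x n] assms by simp
  also have "\<dots> = (\<Sum>i<n. ?B $$ (i, 0) * cofactor ?B i 0)"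
    by (rule laplace_expansion_column[OF B n])
  also have "\<dots> = (\<Sum>i\<in>{0}. ?B $$ (i, 0) * cofactor ?B i 0)"
    using A n by (intro sum.mono_neutral_right) (auto simp: replace_col_def Ax)
  also have "\<dots> = c * det (mat_delete ?B 0 0)"
    using A n by (simp add: replace_col_def Ax cofactor_def)
  also have "mat_delete ?B 0 0 = mat_delete A 0 0"
    using A by (intro eq_matI) (auto simp: mat_delete_def replace_col_def)
  finally show ?thesis .
qed

text \<open>In a row whose entry of the kernel vector has maximal degree, the diagonal term cannot be
  cancelled.\<close>

lemma det_nonzero_diagonal_degree:
  fixes M :: "'a::idom poly mat"
  assumes M: "M \<in> carrier_mat n n"
    and diag: "\<And>i. i < n \<Longrightarrow> degree (M $$ (i, i)) = 1"
    and off: "\<And>i j. i < n \<Longrightarrow> j < n \<Longrightarrow> i \<noteq> j \<Longrightarrow> degree (M $$ (i, j)) = 0"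
  shows "det M \<noteq> 0"
proof
  assume "det M = 0"
  then obtain v where v: "v \<in> carrier_vec n" "v \<noteq> 0\<^sub>v n" "M *\<^sub>v v = 0\<^sub>v n"
    using det_0_iff_vec_prod_zero[OF M] by blast
  then obtain i\<^sub>0 where i\<^sub>0: "i\<^sub>0 < n" "v $ i\<^sub>0 \<noteq> 0"
    by (metis carrier_vecD eq_vecI index_zero_vec)
  let ?I = "{i. i < n \<and> v $ i \<noteq> 0}"
  have "finite ?I" "?I \<noteq> {}" using i\<^sub>0 by auto
  then have "Max ((\<lambda>i. degree (v $ i)) ` ?I) \<in> (\<lambda>i. degree (v $ i)) ` ?I" by simp
  then obtain k where k: "k < n" "v $ k \<noteq> 0"
    and k_max: "Max ((\<lambda>i. degree (v $ i)) ` ?I) = degree (v $ k)" by auto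
  have max: "degree (v $ i) \<le> degree (v $ k)" if "i < n" "v $ i \<noteq> 0" for i
    unfolding k_max[symmetric] using that by (intro Max_ge) auto
  have "(\<Sum>j<n. M $$ (k, j) * v $ j) = (M *\<^sub>v v) $ k"
    using M v(1) k by (auto simp: scalar_prod_def lessThan_atLeast0)
  also have "\<dots> = 0" using v k by simp
  finally have "M $$ (k, k) * v $ k = - (\<Sum>j\<in>{..<n} - {k}. M $$ (k, j) * v $ j)"
    using k by (subst (asm) sum.remove[of _ k]) (auto simp: eq_neg_iff_add_eq_0)
  moreover have "degree (\<Sum>j\<in>{..<n} - {k}. M $$ (k, j) * v $ j) \<le> degree (v $ k)"
  proof (rule degree_sum_le)
    fix j assume j: "j \<in> {..<n} - {k}"
    show "degree (M $$ (k, j) * v $ j) \<le> degree (v $ k)"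
    proof (cases "v $ j = 0")
      case False
      have "degree (M $$ (k, j) * v $ j) \<le> degree (M $$ (k, j)) + degree (v $ j)"
        by (rule degree_mult_le)
      then show ?thesis using max[of j] off[of k j] j k False by auto
    qed simp
  qed simp
  moreover have "M $$ (k, k) \<noteq> 0" using diag[OF k(1)] by auto
  then have "degree (M $$ (k, k) * v $ k) = 1 + degree (v $ k)"
    using diag[OF k(1)] k(2) by (simp add: degree_mult_eq)
  ultimately show False by simp
qed

section \<open>Trees given by a parent function\<close>

text \<open>\<open>depth\<close> certifies that iterating \<open>par\<close> from any vertex ends at
  the root, so \<open>par\<close> cannot run in a circle. The value of \<open>par\<close> at the
  root is left open.\<close>

locale parent_tree =
  fixes V :: "'a set" and root :: 'a and par :: "'a \<Rightarrow> 'a" and depth :: "'a \<Rightarrow> nat"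
  assumes finite_V: "finite V"
    and root_in_V: "root \<in> V"
    and depth_root: "depth root = 0"
    and par_in_V: "v \<in> V \<Longrightarrow> v \<noteq> root \<Longrightarrow> par v \<in> V"
    and depth_par: "v \<in> V \<Longrightarrow> v \<noteq> root \<Longrightarrow> depth v = Suc (depth (par v))"
begin

definition edges :: "('a \<times> 'a) set" where
  "edges = {(v, par v) | v. v \<in> V - {root}} \<union> {(par v, v) | v. v \<in> V - {root}}"

definition tree_graph :: "'a pair_pre_digraph" where
  "tree_graph = \<lparr>pverts = V, parcs = edges\<rparr>"

definition children :: "'a \<Rightarrow> 'a set" where
  "children v = {c \<in> V - {root}. par c = v}"

definition deg :: "'a \<Rightarrow> nat" where
  "deg v = card (children v) + (if v = root then 0 else 1)"

lemma tree_graph_simps [simp]: "pverts tree_graph = V" "parcs tree_graph = edges"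
  by (simp_all add: tree_graph_def)

lemma finite_children: "finite (children v)"
  using finite_V by (simp add: children_def)

lemma childrenD:
  assumes "c \<in> children v"
  shows "c \<in> V" "c \<noteq> root" "par c = v" "depth c = Suc (depth v)"
  using assms depth_par[of c] by (auto simp: children_def)

lemma edges_sym: "(u, v) \<in> edges \<longleftrightarrow> (v, u) \<in> edges"
  by (auto simp: edges_def)

lemma edges_irrefl: "(v, v) \<notin> edges"
proof
  assume "(v, v) \<in> edges"
  then have "v \<in> V" "v \<noteq> root" "par v = v" by (auto simp: edges_def)
  then show False using depth_par[of v] by simp
qed

lemma edges_in_V: "(u, v) \<in> edges \<Longrightarrow> u \<in> V \<and> v \<in> V"
  using par_in_V by (auto simp: edges_def)

lemma neighbours:
  assumes "v \<in> V"
  shows "{u. (v, u) \<in> edges} = children v \<union> (if v = root then {} else {par v})"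
  using assms by (auto simp: edges_def children_def)

lemma par_notin_children: "v \<in> V \<Longrightarrow> v \<noteq> root \<Longrightarrow> par v \<notin> children v"
  using childrenD(4)[of "par v" v] depth_par[of v] by auto

lemma sum_neighbours:
  fixes f :: "'a \<Rightarrow> 'b::comm_monoid_add"
  assumes "v \<in> V"
  shows "(\<Sum>u\<in>V. if (v, u) \<in> edges then f u else 0)
       = (\<Sum>c\<in>children v. f c) + (if v = root then 0 else f (par v))"
proof -
  have "(\<Sum>u\<in>V. if (v, u) \<in> edges then f u else 0) = (\<Sum>u\<in>{u. (v, u) \<in> edges}. f u)"
    using finite_V edges_in_V by (intro sum.mono_neutral_cong_right) auto
  also have "\<dots> = (\<Sum>c\<in>children v. f c) + (if v = root then 0 else f (par v))"
    unfolding neighbours[OF assms]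
    using par_notin_children[OF assms] finite_children by (auto simp: add.commute)
  finally show ?thesis .
qed

lemma degree_of_tree_graph:
  assumes "v \<in> V"
  shows "degree_of tree_graph v = deg v"
proof -
  have "out_arcs (with_proj tree_graph) v = Pair v ` {u. (v, u) \<in> edges}"
    by (auto simp: out_arcs_def)
  then have "degree_of tree_graph v = card {u. (v, u) \<in> edges}"
    by (simp add: out_degree_def card_image inj_on_def)
  then show ?thesis
    unfolding neighbours[OF assms] deg_def
    using par_notin_children[OF assms] finite_children by auto
qed

lemma deg_pos: "v \<noteq> root \<Longrightarrow> deg v > 0"
  by (simp add: deg_def)

definition height :: nat where
  "height = Max (depth ` V)"

lemma depth_le_height: "v \<in> V \<Longrightarrow> depth v \<le> height"
  unfolding height_def using finite_V by simp

lemma tree_induct [consumes 1, case_names children]: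
  assumes "v \<in> V"
    and step: "\<And>v. v \<in> V \<Longrightarrow> (\<And>c. c \<in> children v \<Longrightarrow> P c) \<Longrightarrow> P v"
  shows "P v"
  using assms(1)
proof (induction "height - depth v" arbitrary: v rule: less_induct)
  case less
  show ?case
  proof (rule step[OF less.prems])
    fix c assume c: "c \<in> children v"
    then show "P c"
      using childrenD[OF c] depth_le_height[of c] by (intro less.hyps) auto
  qed
qed

lemma parent_induct [consumes 1, case_names root step]:
  assumes "v \<in> V"
    and "P root"
    and step: "\<And>v. v \<in> V \<Longrightarrow> v \<noteq> root \<Longrightarrow> P (par v) \<Longrightarrow> P v"
  shows "P v"
  using assms(1)
proof (induction "depth v" arbitrary: v)
  case 0
  then have "v = root" using depth_par[of v] by (metis nat.distinct(1))
  then show ?case using assms(2) by simp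
next
  case (Suc n)
  then have v: "v \<noteq> root" using depth_root by (metis nat.distinct(1))
  have "n = depth (par v)" using Suc(2) depth_par[OF Suc(3) v] by simp
  then have "P (par v)" using Suc(1) par_in_V[OF Suc(3) v] by simp
  then show ?case by (rule step[OF Suc(3) v])
qed

section \<open>Branch quotients and the quotient of the determinants\<close>

text \<open>Recursion over children is not structural, so fuel bounds it. Starting with
  \<open>Suc height - depth v\<close>, the fuel drops by one at each child exactly as the depth
  rises; the value 0 without fuel is never reached from a vertex of \<open>V\<close>.\<close>

primrec branch_upto :: "nat \<Rightarrow> 'a \<Rightarrow> ratfun" where
  "branch_upto 0 v = 0"
| "branch_upto (Suc k) v = of_nat (deg v) * zvar - (\<Sum>c\<in>children v. 1 / branch_upto k c)"

text \<open>The quotient of the determinants of \<open>z D - A\<close> on the branch at \<open>v\<close> with and without \<open>v\<close>.\<close>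

definition branch :: "'a \<Rightarrow> ratfun" where
  "branch v = branch_upto (Suc height - depth v) v"

lemma branch_rec:
  assumes "v \<in> V"
  shows "branch v = of_nat (deg v) * zvar - (\<Sum>c\<in>children v. 1 / branch c)"
proof -
  have "Suc height - depth v = Suc (height - depth v)"
    using depth_le_height[OF assms] by simp
  moreover have "branch c = branch_upto (height - depth v) c" if "c \<in> children v" for c
    using childrenD(4)[OF that] by (simp add: branch_def)
  ultimately show ?thesis by (simp add: branch_def)
qed

text \<open>Dividing by \<open>zvar\<close> turns the contribution of a child into
  \<open>1 / z^2\<close> times a term with a finite value, so only the degree survives. That value
  is finite because a non-root vertex has positive degree.\<close>

lemma branch_at_infinity:
  "v \<in> V \<Longrightarrow> value_at_infinity (branch v / zvar) (of_nat (deg v))"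
proof (induction v rule: tree_induct)
  case (children v)
  have "branch v / zvar
      = of_nat (deg v) - (\<Sum>c\<in>children v. (1 / zvar) * (1 / zvar) * (1 / (branch c / zvar)))"
    using zvar_nonzero
    by (simp add: branch_rec[OF children.hyps] diff_divide_distrib sum_divide_distrib mult.commute)
  moreover have "value_at_infinity \<dots>
      (of_nat (deg v) - (\<Sum>c\<in>children v. 0 * 0 * (1 / of_nat (deg c))))"
    using children.IH childrenD(2) deg_pos
    by (intro value_at_infinity_diff value_at_infinity_of_nat value_at_infinity_sum
        value_at_infinity_mult value_at_infinity_inverse_zvar value_at_infinity_inverse)
      (auto simp: neq0_conv[symmetric] simp del: neq0_conv)
  ultimately show ?case by simp
qed

lemma branch_nonzero:
  assumes "v \<in> V" "v \<noteq> root"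
  shows "branch v \<noteq> 0"
proof
  assume "branch v = 0"
  then show False
    using branch_at_infinity[OF assms(1)] deg_pos[OF assms(2)]
    by (simp add: value_at_infinity_zero_iff)
qed

primrec weight_upto :: "nat \<Rightarrow> 'a \<Rightarrow> ratfun" where
  "weight_upto 0 v = 1"
| "weight_upto (Suc k) v = weight_upto k (par v) / branch v"

text \<open>The vector with root entry 1 on which all rows of \<open>-z D + A\<close> but the first one vanish.\<close>

definition weight :: "'a \<Rightarrow> ratfun" where
  "weight v = weight_upto (depth v) v"

lemma weight_root: "weight root = 1"
  by (simp add: weight_def depth_root)

lemma weight_par: "v \<in> V \<Longrightarrow> v \<noteq> root \<Longrightarrow> weight v = weight (par v) / branch v"
  by (simp add: weight_def depth_par[of v])

text \<open>The children contribute \<open>weight v * (deg v * z - branch v)\<close>, whose first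
  part cancels the diagonal. What remains, \<open>- weight v * branch v\<close>, is cancelled by the
  entry at the parent; only the root has no parent.\<close>

lemma weight_row:
  assumes "v \<in> V"
  shows "- zvar * of_nat (deg v) * weight v + (\<Sum>u\<in>V. if (v, u) \<in> edges then weight u else 0)
       = (if v = root then - branch root else 0)"
proof -
  have "(\<Sum>c\<in>children v. weight c) = weight v * (\<Sum>c\<in>children v. 1 / branch c)"
    using childrenD by (simp add: sum_distrib_left weight_par)
  also have "(\<Sum>c\<in>children v. 1 / branch c) = of_nat (deg v) * zvar - branch v"
    using branch_rec[OF assms] by simp
  finally have "- zvar * of_nat (deg v) * weight v
      + (\<Sum>u\<in>V. if (v, u) \<in> edges then weight u else 0)
      = - (weight v * branch v) + (if v = root then 0 else weight (par v))"
    by (simp add: sum_neighbours[OF assms] algebra_simps)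
  then show ?thesis
    using weight_root weight_par[OF assms] branch_nonzero[OF assms] by simp
qed

lemma theta_conv_mat_delete:
  "theta tree_graph vs =
     det (mat_delete ((- [:0, 1:]) \<cdot>\<^sub>m degree_mat tree_graph vs + adjacency_mat tree_graph vs) 0 0)"
  unfolding theta_def
  by (rule arg_cong[of _ _ det], intro eq_matI)
    (auto simp: mat_delete_def degree_mat_def adjacency_mat_def mat_diag_def)

text \<open>Deleting the root leaves vertices of positive degree only, so the diagonal is linear in
  \<open>z\<close> and all other entries are constants.\<close>

lemma theta_nonzero:
  assumes vs: "vertex_order tree_graph root vs"
  shows "theta tree_graph vs \<noteq> 0"
proof -
  let ?n = "length vs"
  define M where
    "M = (- [:0, 1:]) \<cdot>\<^sub>m degree_mat tree_graph vs + adjacency_mat tree_graph vs"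
  let ?N = "mat_delete M 0 0"
  have M: "M \<in> carrier_mat ?n ?n"
    by (simp add: M_def degree_mat_def adjacency_mat_def)
  have N: "?N \<in> carrier_mat (?n - 1) (?n - 1)"
    using M by (rule mat_delete_carrier)
  have "vs \<noteq> []" using vs root_in_V by (auto simp: vertex_order_def)
  have entry: "?N $$ (i, j) = (if i = j then - [:0, 1:] * of_nat (deg (vs ! Suc i)) else 0)
      + (if (vs ! Suc i, vs ! Suc j) \<in> edges then 1 else 0)"
    if "i < ?n - 1" "j < ?n - 1" for i j
  proof -
    have "vs ! Suc i \<in> V" using vs that nth_mem[of "Suc i" vs] by (auto simp: vertex_order_def)
    then show ?thesis
      using that by (auto simp: M_def mat_delete_def degree_mat_def adjacency_mat_def mat_diag_def
          degree_of_tree_graph)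
  qed
  have "det ?N \<noteq> 0"
  proof (rule det_nonzero_diagonal_degree[OF N])
    fix i assume i: "i < ?n - 1"
    have "vs ! Suc i \<noteq> root"
      using vs i \<open>vs \<noteq> []\<close> by (auto simp: vertex_order_def hd_conv_nth nth_eq_iff_index_eq)
    then have "deg (vs ! Suc i) > 0" by (rule deg_pos)
    then show "degree (?N $$ (i, i)) = 1"
      unfolding entry[OF i i] by (simp add: edges_irrefl of_nat_poly)
  next
    fix i j assume ij: "i < ?n - 1" "j < ?n - 1" "i \<noteq> j"
    show "degree (?N $$ (i, j)) = 0" unfolding entry[OF ij(1,2)] using ij(3) by simp
  qed
  then show ?thesis by (simp add: theta_conv_mat_delete M_def)
qed

text \<open>The entries of \<open>weight\<close> are rational functions, so the polynomial matrix is
  moved to the fraction field by \<open>to_fract\<close>, which commutes with determinants and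
  minors.\<close>

lemma psi_theta_quotient:
  assumes vs: "vertex_order tree_graph root vs"
  shows "Fraction_Field.Fract (psi tree_graph vs) (theta tree_graph vs) = - branch root"
proof -
  let ?n = "length vs"
  define M where
    "M = (- [:0, 1:]) \<cdot>\<^sub>m degree_mat tree_graph vs + adjacency_mat tree_graph vs"
  interpret fr: comm_ring_hom "to_fract :: complex poly \<Rightarrow> ratfun" by unfold_locales auto
  have M: "M \<in> carrier_mat ?n ?n"
    by (simp add: M_def degree_mat_def adjacency_mat_def)
  have bij: "bij_betw ((!) vs) {..<?n} V"
    using vs bij_betw_nth[of vs "{..<?n}" V] by (simp add: vertex_order_def)
  have "vs \<noteq> []" using vs root_in_V by (auto simp: vertex_order_def)
  then have vs0: "vs ! 0 = root" using vs by (simp add: vertex_order_def hd_conv_nth)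
  let ?A = "map_mat to_fract M"
  let ?x = "vec ?n (\<lambda>i. weight (vs ! i))"
  have A: "?A \<in> carrier_mat ?n ?n" using M by simp
  have "?A *\<^sub>v ?x = (- branch root) \<cdot>\<^sub>v unit_vec ?n 0"
  proof (rule eq_vecI)
    fix i assume "i < dim_vec ((- branch root) \<cdot>\<^sub>v unit_vec ?n 0)"
    then have i: "i < ?n" by simp
    then have v: "vs ! i \<in> V" using bij by (auto simp: bij_betw_def)
    have zvar: "zvar = to_fract [:0, 1:]" by (simp only: zvar_def to_fract_def)
    have diag: "to_fract (- [:0, 1:] * of_nat d) = - zvar * of_nat d" for d
      by (simp only: fr.hom_mult fr.hom_uminus fr.hom_of_nat zvar)
    have entry: "?A $$ (i, j) = (if i = j then - zvar * of_nat (deg (vs ! i)) else 0)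
        + (if (vs ! i, vs ! j) \<in> edges then 1 else 0)" if j: "j < ?n" for j
    proof -
      have "M $$ (i, j) = (if i = j then - [:0, 1:] * of_nat (deg (vs ! i)) else 0)
          + (if (vs ! i, vs ! j) \<in> edges then 1 else 0)"
        using i j v
        by (auto simp: M_def degree_mat_def adjacency_mat_def mat_diag_def degree_of_tree_graph)
      moreover have "?A $$ (i, j) = to_fract (M $$ (i, j))"
        using carrier_matD[OF M] i j by simp
      ultimately show ?thesis by (simp only: fr.hom_add if_distrib[of to_fract] diag fr.hom_zero fr.hom_one)
    qed
    have "(?A *\<^sub>v ?x) $ i = (\<Sum>j<?n. ?A $$ (i, j) * weight (vs ! j))"
      using carrier_matD[OF A] i by (simp add: scalar_prod_def lessThan_atLeast0 del: index_map_mat)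
    also have "\<dots> = (\<Sum>j<?n. (if i = j then - zvar * of_nat (deg (vs ! i)) * weight (vs ! i) else 0)
        + (if (vs ! i, vs ! j) \<in> edges then weight (vs ! j) else 0))"
      by (intro sum.cong refl) (simp only: entry lessThan_iff distrib_right if_distrib[of "\<lambda>a. a * _"] mult_1_left mult_zero_left cong: if_cong)
    also have "\<dots> = - zvar * of_nat (deg (vs ! i)) * weight (vs ! i)
        + (\<Sum>u\<in>V. if (vs ! i, u) \<in> edges then weight u else 0)"
      using i sum.reindex_bij_betw[OF bij, of "\<lambda>u. if (vs ! i, u) \<in> edges then weight u else 0"]
      by (simp add: sum.distrib)
    also have "\<dots> = (if vs ! i = root then - branch root else 0)"
      by (rule weight_row[OF v])
    also have "\<dots> = ((- branch root) \<cdot>\<^sub>v unit_vec ?n 0) $ i"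
      using i vs vs0 nth_eq_iff_index_eq[of vs i 0] \<open>vs \<noteq> []\<close> by (auto simp: vertex_order_def)
    finally show "(?A *\<^sub>v ?x) $ i = ((- branch root) \<cdot>\<^sub>v unit_vec ?n 0) $ i" .
  qed (use A in simp)
  then have "det ?A = - branch root * det (mat_delete ?A 0 0)"
    using A \<open>vs \<noteq> []\<close> by (intro det_eq_mult_principal_minor[of _ ?n ?x])
      (auto simp: vs0 weight_root)
  moreover have "mat_delete ?A 0 0 = map_mat to_fract (mat_delete M 0 0)"
    by (intro eq_matI) (auto simp: mat_delete_def)
  ultimately have "to_fract (psi tree_graph vs) = - branch root * to_fract (theta tree_graph vs)"
    unfolding psi_def theta_conv_mat_delete M_def[symmetric] by simp
  moreover have "to_fract (theta tree_graph vs) \<noteq> 0"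
    using theta_nonzero[OF vs] by simp
  ultimately show ?thesis
    by (simp only: Fract_conv_to_fract nonzero_mult_div_cancel_right not_False_eq_True)
qed

end

section \<open>Parent functions define finite trees\<close>

context parent_tree begin

lemma rtrancl_edges_root: "v \<in> V \<Longrightarrow> (v, root) \<in> edges\<^sup>*"
proof (induction v rule: parent_induct)
  case (step v)
  then have "(v, par v) \<in> edges" by (auto simp: edges_def)
  then show ?case using step.IH by (rule converse_rtrancl_into_rtrancl)
qed simp

lemma rtrancl_edges:
  assumes "u \<in> V" "v \<in> V"
  shows "(u, v) \<in> edges\<^sup>*"
proof -
  have "(root, v) \<in> edges\<^sup>*"
    using rtrancl_edges_root[OF assms(2)] edges_sym by (meson symD symI sym_rtrancl)
  then show ?thesis using rtrancl_edges_root[OF assms(1)] by simp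
qed

text \<open>One side of the cut obtained by removing the edge between \<open>v\<close> and its
  parent; the closure is reflexive, so \<open>v\<close> belongs to it.\<close>

definition descendants :: "'a \<Rightarrow> 'a set" where
  "descendants v = {x. (x, v) \<in> {(y, par y) | y. y \<in> V - {root}}\<^sup>*}"

text \<open>An arc to a child stays among the descendants. An arc to the parent follows the chain
  leading to \<open>v\<close>, so it stays inside as well unless the chain is empty, that is,
  \<open>a = v\<close>.\<close>

lemma edge_leaving_descendants:
  assumes "(a, b) \<in> edges" "a \<in> descendants v" "b \<notin> descendants v"
  shows "a = v \<and> b = par v"
proof -
  let ?D = "{(y, par y) | y. y \<in> V - {root}}"
  have av: "(a, v) \<in> ?D\<^sup>*" and bv: "(b, v) \<notin> ?D\<^sup>*"
    using assms by (auto simp: descendants_def)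
  have "(b, a) \<notin> ?D"
    using bv converse_rtrancl_into_rtrancl[OF _ av] by blast
  then have "b = par a" using assms(1) by (auto simp: edges_def)
  from av show ?thesis
  proof (cases rule: converse_rtranclE)
    case (step c)
    then have "c = par a" by auto
    then show ?thesis using step bv \<open>b = par a\<close> by simp
  qed (use \<open>b = par a\<close> in simp)
qed

lemma par_notin_descendants:
  assumes "v \<in> V" "v \<noteq> root"
  shows "par v \<notin> descendants v"
proof -
  have "depth v \<le> depth x" if "(x, v) \<in> {(y, par y) | y. y \<in> V - {root}}\<^sup>*" for x
    using that
  proof (induction rule: converse_rtrancl_induct)
    case (step y z)
    then have "depth y = Suc (depth z)" using depth_par[of y] by auto
    then show ?case using step by simp
  qed simp
  from this[of "par v"] show ?thesis
    using depth_par[OF assms] by (auto simp: descendants_def)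
qed

lemma pair_graph_tree_graph: "pair_graph tree_graph"
proof unfold_locales
  have "edges \<subseteq> V \<times> V" using edges_in_V by auto
  then show "finite (parcs tree_graph)"
    using finite_V finite_subset by auto
  show "symmetric (with_proj tree_graph)"
    using edges_sym by (auto simp: symmetric_def sym_def)
next
  fix e assume "e \<in> parcs tree_graph"
  then show "fst e \<in> pverts tree_graph" "snd e \<in> pverts tree_graph" "fst e \<noteq> snd e"
    using edges_in_V edges_irrefl by (cases e, force)+
qed (simp add: finite_V)

text \<open>Any two vertices are joined through the root. After its first arc \<open>(u, v)\<close>,
  a cycle continues as a simple path from \<open>v\<close> to \<open>u\<close>, which must cross the
  cut at this edge and can do so only along \<open>(v, u)\<close>. A simple path from
  \<open>v\<close> to \<open>u\<close> containing that arc consists of it alone, so the cycle has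
  just two arcs.\<close>

lemma finite_tree_tree_graph: "finite_tree tree_graph"
proof -
  interpret G: pair_graph tree_graph by (rule pair_graph_tree_graph)
  have "connected (with_proj tree_graph)"
  proof (rule G.connectedI)
    fix u v assume "u \<in> pverts tree_graph" "v \<in> pverts tree_graph"
    then have "u \<rightarrow>\<^sup>*\<^bsub>with_proj tree_graph\<^esub> v"
      by (subst G.reachable_conv') (auto intro: rtrancl_edges)
    then show "u \<rightarrow>\<^sup>*\<^bsub>with_proj (mk_symmetric (with_proj tree_graph))\<^esub> v"
      using G.reachable_mk_symmetric_eq[OF G.sym_arcs] by simp
  qed (use root_in_V in auto)
  moreover have "\<not> 3 \<le> length c" if cycle: "G.cycle c" for c
  proof
    assume "3 \<le> length c"
    obtain u where "G.awalk u c u" "distinct (tl (G.awalk_verts u c))"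
      using cycle by (auto simp: G.cycle_def)
    moreover obtain e p where c: "c = e # p" using \<open>3 \<le> length c\<close> by (cases c) auto
    ultimately obtain v where e: "(u, v) \<in> edges" and p: "G.apath v p u"
      by (cases e) (auto simp: G.awalk_Cons_iff G.apath_def)
    have cross: "\<exists>(a, b) \<in> set p. a \<in> S \<and> b \<notin> S"
      if "G.awalk x p y" "x \<in> S" "y \<notin> S" for x y p S
      using that
    proof (induction p arbitrary: x)
      case (Cons d q)
      then show ?case by (cases d; cases "snd d \<in> S") (auto simp: G.awalk_Cons_iff)
    qed (simp add: G.awalk_Nil_iff)
    have walk: "G.awalk v p u" and arcs: "set p \<subseteq> edges"
      using p by (auto simp: G.apath_def G.awalk_def)
    consider "v \<in> V" "v \<noteq> root" "u = par v" | "u \<in> V" "u \<noteq> root" "v = par u"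
      using e by (auto simp: edges_def)
    then have "(v, u) \<in> set p"
    proof cases
      case 1
      have "v \<in> descendants v" by (simp add: descendants_def)
      then show ?thesis
        using cross[OF walk, of "descendants v"] edge_leaving_descendants[of _ _ v]
          par_notin_descendants[OF 1(1,2)] arcs 1(3) by fastforce
    next
      case 2
      \<comment> \<open>Here the path enters the descendants instead of leaving them, so the cut
        lemma is applied to the reversed arc.\<close>
      have "u \<in> descendants u" by (simp add: descendants_def)
      then obtain a b where "(a, b) \<in> set p" "a \<notin> descendants u" "b \<in> descendants u"
        using cross[OF walk, of "- descendants u"] par_notin_descendants[OF 2(1,2)] 2(3) by auto
      then show ?thesis
        using edge_leaving_descendants[of b a u] edges_sym arcs 2(3) by auto
    qed
    then obtain q s where pqs: "p = q @ (v, u) # s" by (meson split_list)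
    then have "G.apath v q v" "G.apath u s u"
      using p by (auto simp: G.apath_append_iff G.apath_Cons_iff)
    then have "q = []" "s = []" using G.apath_nonempty_ends by blast+
    then show False using \<open>3 \<le> length c\<close> c pqs by simp
  qed
  ultimately show ?thesis
    unfolding finite_tree_def using pair_graph_tree_graph by blast
qed

end

section \<open>Every finite tree comes from a parent function\<close>

text \<open>If the ends stayed connected without the edge, a simple path back would close up to a
  cycle. It has at least two arcs: it is not empty since there are no loops, and the single arc
  \<open>(v, u)\<close> has been removed.\<close>

lemma finite_tree_bridge:
  assumes "finite_tree G" "(u, v) \<in> parcs G"
  shows "(v, u) \<notin> (parcs G - {(u, v), (v, u)})\<^sup>*"
proof
  interpret G: pair_graph G using assms by (simp add: finite_tree_def)
  define H where "H = \<lparr>pverts = pverts G, parcs = parcs G - {(u, v), (v, u)}\<rparr>"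
  interpret H: pair_wf_digraph H
    by unfold_locales (auto simp: H_def dest: G.arc_fst_in_verts G.arc_snd_in_verts)
  have uv: "u \<in> pverts G" "v \<in> pverts G" "u \<noteq> v"
    using assms(2) G.wellformed' G.no_loops' by blast+
  assume "(v, u) \<in> (parcs G - {(u, v), (v, u)})\<^sup>*"
  then have "v \<rightarrow>\<^sup>*\<^bsub>with_proj H\<^esub> u"
    using uv by (subst H.reachable_conv') (simp_all add: H_def)
  then obtain p where p: "H.apath v p u" by (auto simp: H.reachable_apath)
  then have pH: "set p \<subseteq> parcs H" and "pcas v p u" and dist: "distinct (pawalk_verts v p)"
    by (auto simp: H.apath_def H.awalk_def)
  moreover have "parcs H \<subseteq> parcs G" by (auto simp: H_def)
  ultimately have pG: "G.awalk v p u" using uv by (auto simp: G.awalk_def)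
  have "G.cycle ((u, v) # p)"
    unfolding G.cycle_def using pG dist uv assms(2) by (intro exI[of _ u]) (auto simp: G.awalk_Cons_iff)
  moreover have "2 \<le> length p"
  proof (rule ccontr)
    assume "\<not> 2 \<le> length p"
    then consider "p = []" | e where "p = [e]"
      by (cases p; cases "tl p") auto
    then show False
    proof cases
      case (2 e)
      then have "e = (v, u)" using pG by (cases e) (auto simp: G.awalk_Cons_iff G.awalk_Nil_iff)
      then show False using pH 2 by (simp add: H_def)
    qed (use pG uv in \<open>simp add: G.awalk_Nil_iff\<close>)
  qed
  ultimately show False using assms(1) by (force simp: finite_tree_def)
qed

text \<open>Depth is the distance from \<open>w\<close>, and a parent is any neighbour one step
  closer. Acyclicity enters only in showing that no edge is missed: the parent edges already connect
  all vertices, so any further edge would fail to be a bridge.\<close>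

lemma finite_tree_parent_tree:
  assumes "finite_tree G" "w \<in> pverts G"
  obtains par depth where "parent_tree (pverts G) w par depth"
    and "G = parent_tree.tree_graph (pverts G) w par"
proof -
  interpret G: pair_graph G using assms by (simp add: finite_tree_def)
  define depth where "depth v = (LEAST n. (w, v) \<in> parcs G ^^ n)" for v
  have reach: "(w, v) \<in> parcs G ^^ depth v" if "v \<in> pverts G" for v
  proof -
    have "w \<rightarrow>\<^sup>*\<^bsub>with_proj G\<^esub> v"
      using assms that G.symmetric_connected_imp_strongly_connected[OF G.sym_arcs]
      by (auto simp: finite_tree_def strongly_connected_def)
    then obtain n where "(w, v) \<in> parcs G ^^ n"
      using assms(2) by (auto simp: G.reachable_conv' rtrancl_power)
    then show ?thesis unfolding depth_def by (rule LeastI)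
  qed
  have least: "depth v \<le> n" if "(w, v) \<in> parcs G ^^ n" for v n
    unfolding depth_def using that by (rule Least_le)
  have "\<exists>u. (u, v) \<in> parcs G \<and> depth v = Suc (depth u)" if v: "v \<in> pverts G" "v \<noteq> w" for v
  proof -
    obtain n where n: "depth v = Suc n"
      using reach[OF v(1)] v(2) by (cases "depth v") auto
    then obtain u where u: "(w, u) \<in> parcs G ^^ n" "(u, v) \<in> parcs G"
      using reach[OF v(1)] by auto
    have "(w, u) \<in> parcs G ^^ depth u" using u(2) G.wellformed' by (intro reach) blast
    then have "(w, v) \<in> parcs G ^^ Suc (depth u)" using u(2) by auto
    then have "depth v = Suc (depth u)" using least[of v "Suc (depth u)"] least[OF u(1)] n by simp
    then show ?thesis using u(2) by blast
  qed
  then obtain par where par: "\<And>v. v \<in> pverts G \<Longrightarrow> v \<noteq> w \<Longrightarrow>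
      (par v, v) \<in> parcs G \<and> depth v = Suc (depth (par v))"
    by metis
  interpret T: parent_tree "pverts G" w par depth
  proof
    show "depth w = 0" using least[of w 0] by simp
  qed (use par assms(2) G.wellformed' G.pair_finite_verts in blast)+
  have sub: "T.edges \<subseteq> parcs G"
    using par G.arcs_symmetric by (auto simp: T.edges_def)
  moreover have "parcs G \<subseteq> T.edges"
  proof (rule subrelI, rule ccontr)
    fix u v assume uv: "(u, v) \<in> parcs G" "(u, v) \<notin> T.edges"
    then have "T.edges \<subseteq> parcs G - {(u, v), (v, u)}"
      using sub T.edges_sym by auto
    moreover have "(v, u) \<in> T.edges\<^sup>*"
      using uv(1) G.wellformed' by (intro T.rtrancl_edges) blast+
    ultimately show False
      using finite_tree_bridge[OF assms(1) uv(1)] rtrancl_mono by blast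
  qed
  ultimately have "G = T.tree_graph" by (simp add: T.tree_graph_def)
  then show ?thesis using that T.parent_tree_axioms by blast
qed

section \<open>Recovering the children from the branch quotient\<close>

context parent_tree begin

lemma deg_children: "v \<noteq> root \<Longrightarrow> deg v = Suc (card (children v))"
  by (simp add: deg_def)

lemma leaf_iff_deg: "v \<noteq> root \<Longrightarrow> children v = {} \<longleftrightarrow> deg v = 1"
  using finite_children by (simp add: deg_def)

lemma branch_leaf: "v \<in> V \<Longrightarrow> v \<noteq> root \<Longrightarrow> children v = {} \<Longrightarrow> branch v = zvar"
  by (simp add: branch_rec deg_def)

text \<open>Second-order information at infinity: \<open>zvar\<close> times the sum of
  \<open>1 / branch c\<close> is a sum of terms with values \<open>1 / d(c)\<close>. The result is
  moved to the reals because it is used in inequalities.\<close>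

lemma sum_inverse_deg_children:
  assumes "v \<in> V" and f: "branch v = of_nat (deg v) * zvar - f" and "value_at_infinity (zvar * f) (of_real x)"
  shows "(\<Sum>c\<in>children v. 1 / real (deg c)) = x"
proof -
  have "f = (\<Sum>c\<in>children v. 1 / branch c)"
    using f branch_rec[OF assms(1)] by simp
  then have "zvar * f = (\<Sum>c\<in>children v. 1 / (branch c / zvar))"
    by (simp add: sum_distrib_left)
  moreover have "value_at_infinity \<dots> (\<Sum>c\<in>children v. 1 / of_nat (deg c))"
    using childrenD deg_pos
    by (intro value_at_infinity_sum value_at_infinity_inverse branch_at_infinity) auto
  ultimately have "(\<Sum>c\<in>children v. 1 / of_nat (deg c)) = complex_of_real x"
    using assms(3) value_at_infinity_unique by metis
  then have "complex_of_real (\<Sum>c\<in>children v. 1 / real (deg c)) = complex_of_real x"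
    by simp
  then show ?thesis by (simp only: of_real_eq_iff)
qed

lemma deg_eqI:
  assumes "v \<in> V" "value_at_infinity (branch v / zvar) (of_nat a)"
  shows "deg v = a"
  using value_at_infinity_unique[OF branch_at_infinity[OF assms(1)] assms(2)] by simp

text \<open>There are \<open>a - 1\<close> children, and the reciprocals of their degrees, each at
  most 1, sum to \<open>a - 1\<close>. Hence every reciprocal is 1.\<close>

lemma branch_children_leaves:
  assumes v: "v \<in> V" "v \<noteq> root"
    and f: "branch v = of_nat a * zvar - (of_nat a - 1) / zvar"
  shows "deg v = a" "\<forall>c\<in>children v. children c = {}"
proof -
  have "branch v / zvar = of_nat a - (of_nat a - of_nat 1) * ((1 / zvar) * (1 / zvar))"
    using zvar_nonzero by (simp add: f diff_divide_distrib)
  moreover have "value_at_infinity \<dots> (of_nat a - (of_nat a - of_nat 1) * (0 * 0))"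
    by (intro value_at_infinity_diff value_at_infinity_mult value_at_infinity_of_nat
        value_at_infinity_inverse_zvar)
  ultimately show a: "deg v = a" using v(1) by (intro deg_eqI) simp_all
  have "value_at_infinity (zvar * ((of_nat a - 1) / zvar)) (of_real (real a - 1))"
    using zvar_nonzero value_at_infinity_of_nat_diff[of a 1] by simp
  then have "(\<Sum>c\<in>children v. 1 / real (deg c)) = real a - 1"
    using v f a by (intro sum_inverse_deg_children) auto
  also have "real a - 1 = (\<Sum>c\<in>children v. 1)" using a v by (simp add: deg_children)
  finally have "(\<Sum>c\<in>children v. 1 - 1 / real (deg c)) = 0" by (simp add: sum_subtractf)
  moreover have nonneg: "0 \<le> 1 - 1 / real (deg c)" if "c \<in> children v" for c
    using deg_pos[of c] childrenD[OF that] by simp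
  ultimately have "\<forall>c\<in>children v. 1 - 1 / real (deg c) = 0"
    using sum_nonneg_eq_0_iff[OF finite_children, of v "\<lambda>c. 1 - 1 / real (deg c)"] by blast
  then show "\<forall>c\<in>children v. children c = {}"
    using childrenD leaf_iff_deg by auto
qed

text \<open>The sum of \<open>1 - 1 / d(c)\<close> over the children \<open>c\<close> is \<open>1 - 1 / b < 1\<close>, whereas two children
  that are not leaves would contribute at least \<open>1 / 2\<close> each.\<close>

lemma branch_children_one_nonleaf:
  assumes v: "v \<in> V" "v \<noteq> root"
    and f: "branch v = of_nat a * zvar - (of_nat a - 2) / zvar - 1 / F"
    and F: "value_at_infinity (F / zvar) (of_nat b)" and "2 \<le> b"
  shows "deg v = a"
    and "\<exists>c\<in>children v. branch c = F \<and> (\<forall>c'\<in>children v - {c}. children c' = {})"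
proof -
  have zF: "value_at_infinity (1 / (F / zvar)) (1 / of_nat b)"
    using F \<open>2 \<le> b\<close> by (intro value_at_infinity_inverse) auto
  have "branch v / zvar = of_nat a - (of_nat a - of_nat 2) * ((1 / zvar) * (1 / zvar))
      - (1 / zvar) * (1 / zvar) * (1 / (F / zvar))"
    using zvar_nonzero by (simp add: f diff_divide_distrib)
  moreover have "value_at_infinity \<dots>
      (of_nat a - (of_nat a - of_nat 2) * (0 * 0) - 0 * 0 * (1 / of_nat b))"
    by (intro value_at_infinity_diff value_at_infinity_mult value_at_infinity_of_nat
        value_at_infinity_inverse_zvar zF)
  ultimately show a: "deg v = a" using v(1) by (intro deg_eqI) simp_all
  have "zvar * ((of_nat a - 2) / zvar + 1 / F) = of_nat a - of_nat 2 + 1 / (F / zvar)"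
    using zvar_nonzero by (simp add: distrib_left)
  moreover have "value_at_infinity \<dots> (of_nat a - of_nat 2 + 1 / of_nat b)"
    by (intro value_at_infinity_add value_at_infinity_of_nat_diff zF)
  ultimately have
    "value_at_infinity (zvar * ((of_nat a - 2) / zvar + 1 / F)) (of_real (real a - 2 + 1 / real b))"
    by simp
  then have "(\<Sum>c\<in>children v. 1 / real (deg c)) = real a - 2 + 1 / real b"
    using v f a by (intro sum_inverse_deg_children) auto
  moreover have "(\<Sum>c\<in>children v. 1) = real a - 1" using a v by (simp add: deg_children)
  ultimately have total: "(\<Sum>c\<in>children v. 1 - 1 / real (deg c)) = 1 - 1 / real b"
    by (simp add: sum_subtractf)
  \<comment> \<open>Leaves contribute 0 to \<open>total\<close>, so the whole sum is carried by
    \<open>N\<close>.\<close>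
  define N where "N = {c \<in> children v. deg c \<noteq> 1}"
  have N: "N \<subseteq> children v" "finite N" using finite_children by (auto simp: N_def)
  have sum_N: "(\<Sum>c\<in>N. 1 - 1 / real (deg c)) = 1 - 1 / real b"
    unfolding total[symmetric] using N finite_children
    by (intro sum.mono_neutral_left) (auto simp: N_def)
  have "1 / 2 \<le> 1 - 1 / real (deg c)" if "c \<in> N" for c
  proof -
    have "deg c \<noteq> 0" "deg c \<noteq> 1" using that deg_pos childrenD by (force simp: N_def)+
    then have "2 \<le> deg c" by linarith
    then show ?thesis by (simp add: field_simps)
  qed
  then have "real (card N) * (1 / 2) \<le> 1 - 1 / real b"
    unfolding sum_N[symmetric] by (rule sum_bounded_below)
  moreover have "0 < 1 / real b" "1 / real b \<le> 1 / 2" using \<open>2 \<le> b\<close> by (simp_all add: field_simps)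
  ultimately have "card N < 2" by linarith
  moreover have "N \<noteq> {}" using sum_N \<open>1 / real b \<le> 1 / 2\<close> by auto
  ultimately have "card N = 1" using N by (cases "card N") auto
  then obtain c where c: "N = {c}" by (rule card_1_singletonE)
  have c_child: "c \<in> children v" using c N by auto
  have leaves: "children c' = {}" if "c' \<in> children v - {c}" for c'
  proof -
    have "deg c' = 1" using that c by (auto simp: N_def)
    then show ?thesis using leaf_iff_deg[of c'] childrenD(2)[of c' v] that by auto
  qed
  \<comment> \<open>From here on the identity is exact: the \<open>a - 2\<close> leaves have branch
    \<open>zvar\<close> and cancel against \<open>(a - 2) / z\<close>.\<close>
  have "(of_nat a - 2) / zvar + 1 / F = (\<Sum>x\<in>children v. 1 / branch x)"
    using f a branch_rec[OF v(1)] by (simp add: algebra_simps)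
  also have "\<dots> = 1 / branch c + (\<Sum>x\<in>children v - {c}. 1 / branch x)"
    by (rule sum.remove[OF finite_children c_child])
  also have "(\<Sum>x\<in>children v - {c}. 1 / branch x) = (\<Sum>x\<in>children v - {c}. 1 / zvar)"
    using leaves childrenD by (intro sum.cong refl) (auto simp: branch_leaf)
  also have "\<dots> = (of_nat a - 2) / zvar"
  proof -
    have "a = Suc (card (children v))" using a v by (simp add: deg_children)
    moreover have "card (children v) = Suc (card (children v - {c}))"
      by (rule card.remove[OF finite_children c_child])
    ultimately show ?thesis by simp
  qed
  finally have "1 / F = 1 / branch c" by simp
  then have "branch c = F" by simp
  then show "\<exists>c\<in>children v. branch c = F \<and> (\<forall>c'\<in>children v - {c}. children c' = {})"
    using c_child leaves by blast
qed

lemma card_neighbours: "v \<in> V \<Longrightarrow> card {u. (v, u) \<in> edges} = deg v"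
  using par_notin_children finite_children by (simp add: neighbours deg_def)

end

section \<open>Path lengths in a tree\<close>

lemma set_vwalk_arcs: "set (vwalk_arcs q) = {(q ! k, q ! Suc k) | k. Suc k < length q}"
proof (induction q rule: vwalk_arcs.induct)
  case (3 x y xs)
  have "{(((x # y # xs) ! k), (x # y # xs) ! Suc k) | k. Suc k < length (x # y # xs)}
      = insert (x, y) {((y # xs) ! k, (y # xs) ! Suc k) | k. Suc k < length (y # xs)}"
    (is "?L = ?R")
  proof
    show "?L \<subseteq> ?R"
    proof
      fix e assume "e \<in> ?L"
      then obtain k where "e = ((x # y # xs) ! k, (x # y # xs) ! Suc k)" "k < length (y # xs)"
        by auto
      then show "e \<in> ?R" by (cases k) auto
    qed
    show "?R \<subseteq> ?L" by force
  qed
  then show ?case using 3 by simp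
qed auto

text \<open>Inner vertices of a path are distinct and each has two different neighbours on it; the
  summand 2 accounts for the ends.\<close>

lemma (in parent_tree) length_vpath_le:
  assumes "vpath q (with_proj tree_graph)"
  shows "length q \<le> card {v \<in> V. 2 \<le> deg v} + 2"
proof -
  have q: "distinct q" "set q \<subseteq> V"
    and arcs: "\<And>k. Suc k < length q \<Longrightarrow> (q ! k, q ! Suc k) \<in> edges"
    using assms by (auto simp: vpath_def vwalk_def set_vwalk_arcs)
  let ?I = "{1..<length q - 1}"
  have "2 \<le> deg (q ! k)" if "k \<in> ?I" for k
  proof -
    have k: "Suc k < length q" "0 < k" using that by auto
    then have "{q ! (k - 1), q ! Suc k} \<subseteq> {u. (q ! k, u) \<in> edges}"
      using arcs[of k] arcs[of "k - 1"] edges_sym by auto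
    moreover have "finite {u. (q ! k, u) \<in> edges}"
      using finite_V edges_in_V by (auto intro: finite_subset)
    ultimately have "card {q ! (k - 1), q ! Suc k} \<le> card {u. (q ! k, u) \<in> edges}"
      by (rule card_mono[rotated])
    moreover have "q ! (k - 1) \<noteq> q ! Suc k" using q k by (simp add: nth_eq_iff_index_eq)
    moreover have "q ! k \<in> V" using q k nth_mem[of k q] by auto
    ultimately show ?thesis by (simp add: card_neighbours)
  qed
  then have "(!) q ` ?I \<subseteq> {v \<in> V. 2 \<le> deg v}" using q nth_mem by fastforce
  then have "card ((!) q ` ?I) \<le> card {v \<in> V. 2 \<le> deg v}"
    using finite_V by (intro card_mono) auto
  moreover have "inj_on ((!) q) ?I" using q by (auto intro!: inj_on_nth)
  ultimately show ?thesis by (simp add: card_image)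
qed

section \<open>The caterpillar\<close>

locale stalk_degrees =
  fixes r :: nat and m :: "nat \<Rightarrow> nat"
  assumes r_ge_2: "2 \<le> r"
    and m_ge_2: "1 \<le> i \<Longrightarrow> i \<le> r - 1 \<Longrightarrow> 2 \<le> m i"
begin

lemma cf_tail_last: "cf_tail r m (r - 1) = of_nat (m (r - 1)) * zvar - (of_nat (m (r - 1)) - 1) / zvar"
  by (subst cf_tail.simps) simp

lemma cf_tail_step: "i < r - 1 \<Longrightarrow> cf_tail r m i =
    of_nat (m i) * zvar - (of_nat (m i) - 2) / zvar - 1 / cf_tail r m (Suc i)"
  by (subst cf_tail.simps) simp

text \<open>Descending induction from \<open>r - 1\<close>. The bound 2 on the degrees makes the
  value of the next tail nonzero, so its reciprocal has a finite value.\<close>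

lemma cf_tail_at_infinity:
  assumes "1 \<le> i" "i \<le> r - 1"
  shows "value_at_infinity (cf_tail r m i / zvar) (of_nat (m i))"
  using assms(2,1)
proof (induction rule: inc_induct)
  case base
  have "cf_tail r m (r - 1) / zvar
      = of_nat (m (r - 1)) - (of_nat (m (r - 1)) - of_nat 1) * ((1 / zvar) * (1 / zvar))"
    unfolding cf_tail_last using zvar_nonzero by (simp add: diff_divide_distrib)
  moreover have "value_at_infinity \<dots>
      (of_nat (m (r - 1)) - (of_nat (m (r - 1)) - of_nat 1) * (0 * 0))"
    by (intro value_at_infinity_diff value_at_infinity_mult value_at_infinity_of_nat
        value_at_infinity_inverse_zvar)
  ultimately show ?case by simp
next
  case (step i)
  have "cf_tail r m i / zvar = of_nat (m i) - (of_nat (m i) - of_nat 2) * ((1 / zvar) * (1 / zvar))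
      - (1 / zvar) * (1 / zvar) * (1 / (cf_tail r m (Suc i) / zvar))"
    using zvar_nonzero step.hyps by (simp add: cf_tail_step diff_divide_distrib)
  moreover have "value_at_infinity \<dots> (of_nat (m i) - (of_nat (m i) - of_nat 2) * (0 * 0)
      - 0 * 0 * (1 / of_nat (m (Suc i))))"
    using step m_ge_2[of "Suc i"]
    by (intro value_at_infinity_diff value_at_infinity_mult value_at_infinity_of_nat
        value_at_infinity_inverse_zvar value_at_infinity_inverse) auto
  ultimately show ?case by simp
qed

text \<open>The vertices of the caterpillar are labelled by pairs \<open>(i, j)\<close> where \<open>i\<close> is the distance to
  the root and \<open>j\<close> numbers the vertices at that distance; the stalk consists of the labels
  \<open>(i, 0)\<close>.\<close>

definition level_size :: "nat \<Rightarrow> nat" where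
  "level_size i = (if i \<le> 1 then 1 else m (i - 1) - 1)"

definition labels :: "(nat \<times> nat) set" where
  "labels = {(i, j). i \<le> r \<and> j < level_size i}"

text \<open>The labelling is a parameter so that one definition covers the concrete tree, with
  \<open>prod_encode\<close>, and any tree recovered in the uniqueness proof; isomorphism then
  reduces to comparing injective labellings.\<close>

definition caterpillar :: "(nat \<times> nat \<Rightarrow> 'a) \<Rightarrow> 'a pair_pre_digraph" where
  "caterpillar h = \<lparr>pverts = h ` labels,
     parcs = {(h (i, 0), h (Suc i, j)) | i j. (Suc i, j) \<in> labels} \<union>
             {(h (Suc i, j), h (i, 0)) | i j. (Suc i, j) \<in> labels}\<rparr>"

text \<open>Level \<open>i\<close> with \<open>i > 1\<close> holds the children of the stalk vertex
  at \<open>i - 1\<close>, one fewer than its degree because of the parent; degree at least 2 leaves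
  one child to continue the stalk.\<close>

lemma level_size_pos: "i \<le> r \<Longrightarrow> 0 < level_size i"
proof (cases "i \<le> 1")
  case False
  moreover assume "i \<le> r"
  ultimately have "2 \<le> m (i - 1)" by (intro m_ge_2) auto
  then show ?thesis by (simp add: level_size_def)
qed (simp add: level_size_def)

lemma finite_labels: "finite labels"
proof -
  have "labels = Sigma {..r} (\<lambda>i. {..<level_size i})" by (auto simp: labels_def)
  then show ?thesis by simp
qed

lemma stalk_in_labels: "i \<le> r \<Longrightarrow> (i, 0) \<in> labels"
  using level_size_pos by (simp add: labels_def)

lemma caterpillar_simps [simp]:
  "pverts (caterpillar h) = h ` labels"
  "parcs (caterpillar h) = {(h (i, 0), h (Suc i, j)) | i j. (Suc i, j) \<in> labels} \<union>
     {(h (Suc i, j), h (i, 0)) | i j. (Suc i, j) \<in> labels}"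
  by (simp_all add: caterpillar_def)

text \<open>The tree claimed to exist has vertices of type \<open>nat\<close>, so labels are coded
  as numbers.\<close>

definition codes :: "nat set" where
  "codes = prod_encode ` labels"

text \<open>Every parent is a stalk vertex. At the root, truncated subtraction returns the root
  itself.\<close>

definition code_par :: "nat \<Rightarrow> nat" where
  "code_par x = prod_encode (fst (prod_decode x) - 1, 0)"

definition code_depth :: "nat \<Rightarrow> nat" where
  "code_depth x = fst (prod_decode x)"

lemma code_simps [simp]:
  "prod_encode x \<in> codes \<longleftrightarrow> x \<in> labels"
  "code_par (prod_encode (i, j)) = prod_encode (i - 1, 0)"
  "code_depth (prod_encode (i, j)) = i"
  by (auto simp: codes_def code_par_def code_depth_def)

lemma codesE:
  assumes "x \<in> codes"
  obtains i j where "x = prod_encode (i, j)" "(i, j) \<in> labels"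
  using assms by (auto simp: codes_def)

lemma label_0_iff: "(0, j) \<in> labels \<longleftrightarrow> j = 0"
  by (simp add: labels_def level_size_def)

sublocale C: parent_tree codes "prod_encode (0, 0)" code_par code_depth
proof
  show "finite codes" by (simp add: codes_def finite_labels)
next
  fix v assume "v \<in> codes" "v \<noteq> prod_encode (0, 0)"
  then obtain i j where ij: "v = prod_encode (i, j)" "(i, j) \<in> labels" "(i, j) \<noteq> (0, 0)"
    by (auto elim: codesE)
  then have "i \<noteq> 0" using label_0_iff by metis
  then show "code_par v \<in> codes" "code_depth v = Suc (code_depth (code_par v))"
    using ij(1,2) stalk_in_labels[of "i - 1"] by (auto simp: labels_def)
qed (auto intro: stalk_in_labels)

lemma nonroot_codes:
  "x \<in> codes - {prod_encode (0, 0)} \<longleftrightarrow>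
    (\<exists>i j. x = prod_encode (Suc i, j) \<and> (Suc i, j) \<in> labels)"
proof
  assume "x \<in> codes - {prod_encode (0, 0)}"
  then obtain i j where ij: "x = prod_encode (i, j)" "(i, j) \<in> labels" "(i, j) \<noteq> (0, 0)"
    by (auto elim: codesE)
  then have "i \<noteq> 0" using label_0_iff by metis
  then show "\<exists>i j. x = prod_encode (Suc i, j) \<and> (Suc i, j) \<in> labels"
    using ij by (metis not0_implies_Suc)
qed auto

lemma tree_graph_caterpillar: "C.tree_graph = caterpillar prod_encode"
proof -
  have "C.edges = parcs (caterpillar prod_encode)"
    unfolding C.edges_def nonroot_codes by auto
  then show ?thesis by (simp add: C.tree_graph_def caterpillar_def) (simp add: codes_def)
qed

lemma children_stalk: "C.children (prod_encode (i, 0)) = {prod_encode (Suc i, j) | j. (Suc i, j) \<in> labels}"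
  unfolding C.children_def nonroot_codes by auto

lemma children_side: "j \<noteq> 0 \<Longrightarrow> C.children (prod_encode (i, j)) = {}"
  unfolding C.children_def nonroot_codes by auto

lemma children_stalk_image: "i < r \<Longrightarrow>
    C.children (prod_encode (i, 0)) = (\<lambda>j. prod_encode (Suc i, j)) ` {..<level_size (Suc i)}"
  unfolding children_stalk by (auto simp: labels_def)

lemma children_end: "C.children (prod_encode (r, 0)) = {}"
  unfolding children_stalk by (auto simp: labels_def)

lemma card_children_stalk: "i < r \<Longrightarrow> card (C.children (prod_encode (i, 0))) = level_size (Suc i)"
  unfolding children_stalk_image by (simp add: card_image inj_on_def)

lemma deg_root: "C.deg (prod_encode (0, 0)) = 1"
  using r_ge_2 by (simp add: C.deg_def card_children_stalk level_size_def)

lemma deg_end: "C.deg (prod_encode (r, 0)) = 1"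
  using r_ge_2 by (simp add: C.deg_def children_end)

lemma deg_side: "j \<noteq> 0 \<Longrightarrow> C.deg (prod_encode (i, j)) = 1"
  by (simp add: C.deg_def children_side)

lemma deg_stalk: "1 \<le> i \<Longrightarrow> i \<le> r - 1 \<Longrightarrow> C.deg (prod_encode (i, 0)) = m i"
  using m_ge_2[of i] r_ge_2 by (simp add: C.deg_def card_children_stalk level_size_def)

text \<open>Descending induction along the stalk. At \<open>r - 1\<close> every child is a leaf,
  including the end of the stalk; earlier, the child numbered 0 carries the next tail and the others
  are leaves.\<close>

lemma branch_stalk:
  assumes "1 \<le> i" "i \<le> r - 1"
  shows "C.branch (prod_encode (i, 0)) = cf_tail r m i"
  using assms(2,1)
proof (induction rule: inc_induct)
  case base
  have ls: "level_size r = m (r - 1) - 1" using r_ge_2 by (simp add: level_size_def)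
  have leaf: "C.branch (prod_encode (r, j)) = zvar" if "j < level_size r" for j
    using that r_ge_2 children_end children_side
    by (cases j) (auto intro!: C.branch_leaf simp: labels_def)
  have "C.branch (prod_encode (r - 1, 0)) = of_nat (m (r - 1)) * zvar
      - (\<Sum>c\<in>(\<lambda>j. prod_encode (r, j)) ` {..<level_size r}. 1 / C.branch c)"
    using C.branch_rec[of "prod_encode (r - 1, 0)"] deg_stalk[of "r - 1"] base r_ge_2
      children_stalk_image[of "r - 1"] stalk_in_labels[of "r - 1"] by auto
  also have "\<dots> = of_nat (m (r - 1)) * zvar - (of_nat (m (r - 1)) - 1) / zvar"
    using leaf m_ge_2[of "r - 1"] base
    by (subst sum.reindex) (auto simp: inj_on_def ls of_nat_diff)
  finally show ?case by (simp only: cf_tail_last)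
next
  case (step i)
  let ?n = "level_size (Suc i)"
  \<comment> \<open>The successor form isolates the summand \<open>j = 0\<close>, the stalk child,
    from the \<open>m i - 2\<close> leaves.\<close>
  have ls: "?n = Suc (m i - 2)" using step.prems m_ge_2[of i] step.hyps by (simp add: level_size_def)
  have leaf: "C.branch (prod_encode (Suc i, Suc j)) = zvar" if "j < m i - 2" for j
    using that step.hyps children_side by (intro C.branch_leaf) (auto simp: labels_def ls)
  have "C.branch (prod_encode (i, 0)) = of_nat (m i) * zvar
      - (\<Sum>c\<in>(\<lambda>j. prod_encode (Suc i, j)) ` {..<?n}. 1 / C.branch c)"
    using C.branch_rec[of "prod_encode (i, 0)"] deg_stalk[of i] step.hyps step.prems
      children_stalk_image[of i] stalk_in_labels[of i] by auto
  also have "\<dots> = of_nat (m i) * zvar - (\<Sum>j<?n. 1 / C.branch (prod_encode (Suc i, j)))"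
    by (subst sum.reindex) (auto simp: inj_on_def)
  also have "\<dots> = of_nat (m i) * zvar - (of_nat (m i) - 2) / zvar - 1 / cf_tail r m (Suc i)"
    unfolding ls sum.lessThan_Suc_shift using leaf m_ge_2[of i] step
    by (simp add: of_nat_diff)
  finally show ?case using step.hyps by (simp add: cf_tail_step)
qed

lemma branch_root: "C.branch (prod_encode (0, 0)) = - cont_frac r m"
proof -
  have "C.children (prod_encode (0, 0)) = {prod_encode (1, 0)}"
    using children_stalk_image[of 0] r_ge_2 by (auto simp: level_size_def)
  then show ?thesis
    using C.branch_rec[of "prod_encode (0, 0)"] r_ge_2 stalk_in_labels[of 0]
    by (simp add: deg_root branch_stalk cont_frac_def)
qed

lemma pendant_rooted_tree_caterpillar:
  "pendant_rooted_tree (caterpillar prod_encode) (prod_encode (0, 0))"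
  unfolding pendant_rooted_tree_def tree_graph_caterpillar[symmetric]
  using C.finite_tree_tree_graph C.degree_of_tree_graph[OF C.root_in_V] C.root_in_V deg_root by simp

lemma caterpillar_with_stalk_caterpillar:
  "caterpillar_with_stalk (caterpillar prod_encode) (map (\<lambda>i. prod_encode (i, 0)) [0..<Suc r])"
proof -
  let ?s = "map (\<lambda>i. prod_encode (i, 0)) [0..<Suc r]"
  have "set (vwalk_arcs ?s) \<subseteq> parcs (caterpillar prod_encode)"
  proof
    fix e assume "e \<in> set (vwalk_arcs ?s)"
    then obtain k where "e = (prod_encode (k, 0), prod_encode (Suc k, 0))" "Suc k \<le> r"
      by (auto simp: set_vwalk_arcs simp del: upt_Suc)
    then show "e \<in> parcs (caterpillar prod_encode)"
      using stalk_in_labels[of "Suc k"] by auto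
  qed
  moreover have "set ?s \<subseteq> prod_encode ` labels" using stalk_in_labels by auto
  ultimately have path: "vpath ?s (with_proj (caterpillar prod_encode))"
    by (auto simp: vpath_def vwalk_def distinct_map inj_on_def simp del: upt_Suc)
  \<comment> \<open>Only the \<open>r - 1\<close> inner stalk vertices have degree at least 2, so a
    path has at most \<open>(r - 1) + 2\<close> vertices.\<close>
  have longest: "length q \<le> r + 1" if "vpath q (with_proj (caterpillar prod_encode))" for q
  proof -
    have "{v \<in> codes. 2 \<le> C.deg v} \<subseteq> (\<lambda>i. prod_encode (i, 0)) ` {1..r - 1}"
    proof
      fix v assume "v \<in> {v \<in> codes. 2 \<le> C.deg v}"
      then obtain i j where v: "v = prod_encode (i, j)" "i \<le> r" "2 \<le> C.deg v"
        by (auto simp: labels_def elim: codesE)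
      then have "j = 0" using deg_side[of j i] by (cases "j = 0") auto
      moreover then have "i \<noteq> 0" "i \<noteq> r" 
        using v(3) deg_root deg_end unfolding v(1) by (auto intro!: gr0I)
      ultimately show "v \<in> (\<lambda>i. prod_encode (i, 0)) ` {1..r - 1}" using v by auto
    qed
    then have "card {v \<in> codes. 2 \<le> C.deg v} \<le> r - 1"
      using surj_card_le[of "{1..r - 1}"] by simp
    then show ?thesis
      using C.length_vpath_le[of q] that r_ge_2 unfolding tree_graph_caterpillar by simp
  qed
  have near: "\<exists>u\<in>set ?s. v = u \<or> (u, v) \<in> parcs (caterpillar prod_encode)"
    if v_in: "v \<in> pverts (caterpillar prod_encode)" for v
  proof -
    obtain i j where v: "v = prod_encode (i, j)" "(i, j) \<in> labels" using v_in by auto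
    then have "i \<le> r" by (simp add: labels_def)
    show ?thesis
    proof (cases i)
      case 0
      then show ?thesis using v \<open>i \<le> r\<close> by (auto simp: label_0_iff simp del: upt_Suc)
    next
      case (Suc k)
      then have "prod_encode (k, 0) \<in> set ?s" using \<open>i \<le> r\<close> by (auto simp del: upt_Suc)
      moreover have "(prod_encode (k, 0), v) \<in> parcs (caterpillar prod_encode)" using v Suc by auto
      ultimately show ?thesis by blast
    qed
  qed
  show ?thesis
    unfolding caterpillar_with_stalk_def
  proof (intro conjI allI impI ballI)
    show "finite_tree (caterpillar prod_encode)"
      using C.finite_tree_tree_graph by (simp only: tree_graph_caterpillar)
    show "vwalk_length q \<le> vwalk_length ?s" if "vpath q (with_proj (caterpillar prod_encode))" for q
      using longest[OF that] by simp
  qed (fact path near)+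
qed

end

section \<open>Enumerations and relabelling isomorphisms\<close>

text \<open>Used to number the children of a stalk vertex so that the next stalk vertex gets the
  number 0.\<close>

lemma ex_enumeration_starting_with:
  assumes "finite A" "x \<in> A"
  shows "\<exists>g. bij_betw g {..<card A} A \<and> g (0::nat) = x"
proof -
  obtain xs where xs: "set xs = A - {x}" "distinct xs"
    using finite_distinct_list[of "A - {x}"] assms by auto
  then have "distinct (x # xs)" "set (x # xs) = A" using assms by auto
  then have "bij_betw ((!) (x # xs)) {..<card A} A"
    by (intro bij_betw_nth) (auto simp flip: distinct_card)
  then show ?thesis by (intro exI[of _ "(!) (x # xs)"]) simp
qed

lemma rooted_iso_image:
  assumes "pair_wf_digraph G" "inj_on f (pverts G)"
    and "pverts H = f ` pverts G" "parcs H = map_prod f f ` parcs G"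
  shows "rooted_iso G v H (f v)"
proof -
  interpret pair_wf_digraph G by fact
  let ?h = "\<lparr>iso_verts = f, iso_arcs = map_prod f f, iso_head = snd, iso_tail = fst\<rparr>"
  have "parcs G \<subseteq> pverts G \<times> pverts G" using wellformed' by auto
  moreover have "inj_on (map_prod f f) (pverts G \<times> pverts G)"
    using assms(2) by (rule map_prod_inj_on[OF _ assms(2)])
  ultimately have "inj_on (map_prod f f) (parcs G)" using inj_on_subset by blast
  then have "digraph_isomorphism ?h"
    using assms(2) wf_digraph by (simp add: digraph_isomorphism_def)
  moreover have "with_proj H = app_iso ?h (with_proj G)"
    using assms(3,4) by (simp add: with_proj_def app_iso_def)
  ultimately show ?thesis unfolding rooted_iso_def by (intro exI[of _ ?h]) simp
qed

lemma (in stalk_degrees) rooted_iso_caterpillar: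
  assumes "inj_on h labels"
  shows "rooted_iso (caterpillar prod_encode) (prod_encode (0, 0)) (caterpillar h) (h (0, 0))"
proof -
  let ?f = "h \<circ> prod_decode"
  have "pair_wf_digraph (caterpillar prod_encode)"
    using C.pair_graph_tree_graph unfolding tree_graph_caterpillar pair_graph_def pair_digraph_def
      pair_fin_digraph_def by blast
  moreover have "inj_on ?f (pverts (caterpillar prod_encode))"
    using assms by (auto simp: inj_on_def)
  moreover have "pverts (caterpillar h) = ?f ` pverts (caterpillar prod_encode)"
    by (simp add: image_image)
  moreover have "parcs (caterpillar h) = map_prod ?f ?f ` parcs (caterpillar prod_encode)"
  proof -
    have "map_prod ?f ?f ` {(a i j, b i j) | i j. P i j} = {(?f (a i j), ?f (b i j)) | i j. P i j}"
      for a b :: "nat \<Rightarrow> nat \<Rightarrow> nat" and P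
      by force
    then show ?thesis by (simp add: image_Un)
  qed
  ultimately have "rooted_iso (caterpillar prod_encode) (prod_encode (0, 0)) (caterpillar h)
      (?f (prod_encode (0, 0)))"
    by (rule rooted_iso_image)
  then show ?thesis by simp
qed

section \<open>Uniqueness\<close>

locale stalk_degrees_tree = stalk_degrees r m + parent_tree V root par depth
  for r m and V :: "'a set" and root par depth +
  assumes deg_root: "deg root = 1" and branch_root: "branch root = - cont_frac r m"
begin

text \<open>The stalk is chosen vertex by vertex with the invariant
  \<open>branch v = cf_tail r m i\<close>. The only child of the root satisfies it by comparing
  \<open>zvar - 1 / branch c\<close> with the continued fraction.\<close>

lemma stalk_exists:
  obtains s where "s 0 = root" "\<And>i. i \<le> r \<Longrightarrow> s i \<in> V" "children (s r) = {}"
    and "\<And>i. i < r \<Longrightarrow> s (Suc i) \<in> children (s i)"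
    and "\<And>i. i < r \<Longrightarrow> card (children (s i)) = level_size (Suc i)"
    and "\<And>i c. i < r \<Longrightarrow> c \<in> children (s i) \<Longrightarrow> c \<noteq> s (Suc i) \<Longrightarrow> children c = {}"
proof -
  \<comment> \<open>Dependent choice produces an infinite sequence, so \<open>P\<close> and
    \<open>Q\<close> are made vacuous beyond the stalk.\<close>
  define P where "P i v \<longleftrightarrow> (i \<le> r \<longrightarrow> v \<in> V) \<and> (i = 0 \<longrightarrow> v = root) \<and>
    (1 \<le> i \<and> i < r \<longrightarrow> v \<noteq> root \<and> branch v = cf_tail r m i) \<and> (i = r \<longrightarrow> children v = {})" for i v
  define Q where "Q i v c \<longleftrightarrow> (i < r \<longrightarrow> c \<in> children v \<and> card (children v) = level_size (Suc i) \<and>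
    (\<forall>c'\<in>children v - {c}. children c' = {}))" for i v c
  have base: "P 0 root" using root_in_V r_ge_2 by (simp add: P_def)
  have step: "\<exists>c. P (Suc i) c \<and> Q i v c" if Pv: "P i v" for i v
  proof -
    consider "i \<ge> r" | "i = 0" | "1 \<le> i" "i < r - 1" | "1 \<le> i" "i = r - 1" by linarith
    then show ?thesis
    proof cases
      case 1
      then show ?thesis by (auto simp: P_def Q_def)
    next
      case 2
      then have v: "v = root" using Pv by (simp add: P_def)
      have "card (children root) = 1" using deg_root by (simp add: deg_def)
      then obtain c where c: "children root = {c}" by (rule card_1_singletonE)
      have "- cont_frac r m = zvar - 1 / branch c"
        using branch_rec[OF root_in_V] by (simp add: branch_root deg_root c)
      then have "branch c = cf_tail r m 1" by (simp add: cont_frac_def)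
      then have "P (Suc i) c \<and> Q i v c"
        using 2 v c childrenD[of c root] r_ge_2 by (simp add: P_def Q_def level_size_def)
      then show ?thesis by blast
    next
      case 3
      then have v: "v \<in> V" "v \<noteq> root" and b: "branch v = cf_tail r m i"
        using Pv by (auto simp: P_def)
      have F: "value_at_infinity (cf_tail r m (Suc i) / zvar) (of_nat (m (Suc i)))"
        using 3 by (intro cf_tail_at_infinity) auto
      have m: "2 \<le> m (Suc i)" using 3 by (intro m_ge_2) auto
      note step = branch_children_one_nonleaf[OF v b[unfolded cf_tail_step[OF 3(2)]] F m]
      obtain c where c: "c \<in> children v" "branch c = cf_tail r m (Suc i)"
        "\<forall>c'\<in>children v - {c}. children c' = {}" using step(2) by blast
      have "card (children v) = level_size (Suc i)"
        using step(1) v 3 by (simp add: deg_children level_size_def)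
      then have "Q i v c" using c(1,3) unfolding Q_def by blast
      moreover have "P (Suc i) c" using 3 c(2) childrenD(1,2)[OF c(1)] by (auto simp: P_def)
      ultimately show ?thesis by blast
    next
      case 4
      then have v: "v \<in> V" "v \<noteq> root" and b: "branch v = cf_tail r m (r - 1)"
        using Pv by (auto simp: P_def)
      note leaves = branch_children_leaves[OF v b[unfolded cf_tail_last]]
      have card: "card (children v) = level_size (Suc i)"
        using leaves(1) v 4 r_ge_2 by (simp add: deg_children level_size_def)
      \<comment> \<open>All children are leaves here, so any of them can serve as the end of the
        stalk.\<close>
      then have "card (children v) > 0" using 4 by (simp add: level_size_pos)
      then obtain c where c: "c \<in> children v" by (metis card.empty equals0I less_numeral_extra(3))
      then have "Q i v c" using card leaves(2) unfolding Q_def by blast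
      moreover have "P (Suc i) c"
        using 4 childrenD(1)[OF c] leaves(2)[rule_format, OF c] by (auto simp: P_def)
      ultimately show ?thesis by blast
    qed
  qed
  obtain s where s: "\<And>i. P i (s i)" "\<And>i. Q i (s i) (s (Suc i))"
    using dependent_nat_choice[of P Q] base step by metis
  show ?thesis
  proof (rule that[of s])
    show "s 0 = root" "children (s r) = {}" using s(1)[of 0] s(1)[of r] by (auto simp: P_def)
    show "s i \<in> V" if "i \<le> r" for i using s(1)[of i] that by (simp add: P_def)
    show "s (Suc i) \<in> children (s i)" "card (children (s i)) = level_size (Suc i)" if "i < r" for i
      using s(2)[of i] that unfolding Q_def by blast+
    show "children c = {}" if "i < r" "c \<in> children (s i)" "c \<noteq> s (Suc i)" for i c
      using s(2)[of i] that unfolding Q_def by blast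
  qed
qed

text \<open>Every vertex with children lies on the stalk, so the children of the stalk vertices
  exhaust all vertices but the root and can be labelled level by level.\<close>

lemma labelling_exists:
  obtains h where "inj_on h labels" "h (0, 0) = root" "tree_graph = caterpillar h"
proof -
  obtain s where s0: "s 0 = root" and sV: "\<And>i. i \<le> r \<Longrightarrow> s i \<in> V" and sr: "children (s r) = {}"
    and s_child: "\<And>i. i < r \<Longrightarrow> s (Suc i) \<in> children (s i)"
    and s_card: "\<And>i. i < r \<Longrightarrow> card (children (s i)) = level_size (Suc i)"
    and s_leaf: "\<And>i c. i < r \<Longrightarrow> c \<in> children (s i) \<Longrightarrow> c \<noteq> s (Suc i) \<Longrightarrow> children c = {}"
    by (rule stalk_exists) blast
  have "\<exists>g. bij_betw g {..<level_size (Suc i)} (children (s i)) \<and> g (0::nat) = s (Suc i)"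
    if "i < r" for i
    using ex_enumeration_starting_with[OF finite_children s_child[OF that]] s_card[OF that] by simp
  then obtain g where g: "\<And>i. i < r \<Longrightarrow> bij_betw (g i) {..<level_size (Suc i)} (children (s i))"
    and g0: "\<And>i. i < r \<Longrightarrow> g i (0::nat) = s (Suc i)"
    by metis
  define h where "h = (\<lambda>(i, j). case i of 0 \<Rightarrow> root | Suc k \<Rightarrow> g k j)"
  have h_stalk: "h (i, 0) = s i" if "i \<le> r" for i
    using that s0 g0 by (cases i) (auto simp: h_def)
  have h_child: "h (Suc i, j) \<in> children (s i)" if "(Suc i, j) \<in> labels" for i j
    using that bij_betwE[OF g[of i]] by (auto simp: labels_def h_def)
  \<comment> \<open>Descending from the root: the parent of such a vertex is on the stalk, so a
    child that is not a leaf must be the next stalk vertex, and it is not the childless end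
    \<open>s r\<close>.\<close>
  have nonleaf: "\<exists>i<r. v = s i" if "v \<in> V" "children v \<noteq> {}" for v
    using that
  proof (induction v rule: parent_induct)
    case root
    then show ?case using s0 r_ge_2 by (intro exI[of _ 0]) simp
  next
    case (step v)
    have v: "v \<in> children (par v)" using step.hyps by (simp add: children_def)
    then obtain i where i: "i < r" "par v = s i" using step.IH by auto
    then have "v = s (Suc i)" using s_leaf[of i v] v step.prems by auto
    moreover from this have "Suc i \<noteq> r" using sr step.prems by auto
    ultimately show ?case using i by (intro exI[of _ "Suc i"]) simp
  qed
  have nonroot: "v \<in> V - {root} \<longleftrightarrow> (\<exists>i j. (Suc i, j) \<in> labels \<and> v = h (Suc i, j))" for v
  proof
    assume v: "v \<in> V - {root}"
    then have v': "v \<in> children (par v)" by (simp add: children_def)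
    then obtain i where i: "i < r" "par v = s i" using nonleaf[of "par v"] v par_in_V by auto
    then obtain j where "j < level_size (Suc i)" "v = g i j"
      using v' g[OF i(1)] by (auto simp: bij_betw_def)
    then show "\<exists>i j. (Suc i, j) \<in> labels \<and> v = h (Suc i, j)"
      using i by (intro exI[of _ i] exI[of _ j]) (simp add: labels_def h_def)
  next
    assume "\<exists>i j. (Suc i, j) \<in> labels \<and> v = h (Suc i, j)"
    then show "v \<in> V - {root}" using h_child childrenD by blast
  qed
  have h_par: "par (h (Suc i, j)) = h (i, 0)" if "(Suc i, j) \<in> labels" for i j
    using childrenD(3)[OF h_child[OF that]] h_stalk[of i] that by (simp add: labels_def)
  have s_depth: "depth (s i) = i" if "i \<le> r" for i
    using that
  proof (induction i)
    case (Suc i)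
    then show ?case using childrenD(4)[OF s_child[of i]] by simp
  qed (simp add: s0 depth_root)
  \<comment> \<open>The depth recovers the first component of a label, so injectivity only has to be
    checked within a level.\<close>
  have h_depth: "depth (h (i, j)) = i" if "(i, j) \<in> labels" for i j
  proof (cases i)
    case (Suc k)
    then show ?thesis using childrenD(4)[OF h_child[of k j]] s_depth[of k] that
      by (simp add: labels_def)
  qed (simp add: h_def depth_root)
  have "inj_on h labels"
  proof (rule inj_onI)
    fix x y assume xy: "x \<in> labels" "y \<in> labels" "h x = h y"
    obtain i j k where x: "x = (i, j)" and y: "y = (i, k)"
      using xy h_depth by (metis prod.exhaust_sel)
    show "x = y"
    proof (cases i)
      case 0
      then show ?thesis using xy x y by (simp add: label_0_iff)
    next
      case (Suc l)
      then have "l < r" "j < level_size (Suc l)" "k < level_size (Suc l)" "g l j = g l k"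
        using xy x y by (auto simp: labels_def h_def)
      then show ?thesis using g[of l] x y by (auto simp: bij_betw_def inj_on_def)
    qed
  qed
  moreover have "h (0, 0) = root" by (simp add: h_def)
  moreover have "tree_graph = caterpillar h"
  proof -
    have "V = h ` labels"
    proof
      show "V \<subseteq> h ` labels"
      proof
        fix v assume "v \<in> V"
        then show "v \<in> h ` labels"
          using nonroot[of v] stalk_in_labels[of 0] \<open>h (0, 0) = root\<close> by (cases "v = root") force+
      qed
      show "h ` labels \<subseteq> V"
      proof
        fix v assume "v \<in> h ` labels"
        then obtain i j where v: "v = h (i, j)" "(i, j) \<in> labels" by auto
        then show "v \<in> V"
          using nonroot[of v] root_in_V by (cases i) (auto simp: h_def)
      qed
    qed
    moreover have "edges = {(h (i, 0), h (Suc i, j)) | i j. (Suc i, j) \<in> labels} \<union>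
        {(h (Suc i, j), h (i, 0)) | i j. (Suc i, j) \<in> labels}"
      unfolding edges_def nonroot by (auto simp: h_par) (metis h_par)+
    ultimately show ?thesis unfolding tree_graph_def caterpillar_def by simp
  qed
  ultimately show ?thesis using that by blast
qed

end

section \<open>Existence and uniqueness combined\<close>

context stalk_degrees
begin

lemma caterpillar_quotient:
  assumes "vertex_order (caterpillar prod_encode) (prod_encode (0, 0)) vs"
  shows "Fraction_Field.Fract (psi (caterpillar prod_encode) vs) (theta (caterpillar prod_encode) vs)
    = cont_frac r m"
  using C.psi_theta_quotient[of vs] assms by (simp add: tree_graph_caterpillar branch_root)

text \<open>One enumeration \<open>ws\<close> with the right quotient is enough: every enumeration
  gives the quotient \<open>- branch w\<close>, so the hypothesis turns into an equation free of the
  ordering.\<close>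

lemma caterpillar_unique:
  assumes T: "pendant_rooted_tree T w" and ws: "vertex_order T w ws"
    and quot: "Fraction_Field.Fract (psi T ws) (theta T ws) = cont_frac r m"
  shows "rooted_iso (caterpillar prod_encode) (prod_encode (0, 0)) T w"
proof -
  have "finite_tree T" "w \<in> pverts T" using T by (auto simp: pendant_rooted_tree_def)
  then obtain par depth where pt: "parent_tree (pverts T) w par depth"
    and tg: "T = parent_tree.tree_graph (pverts T) w par"
    by (rule finite_tree_parent_tree)
  interpret P: parent_tree "pverts T" w par depth by (rule pt)
  have "P.deg w = 1"
    using P.degree_of_tree_graph[OF P.root_in_V] T by (simp add: pendant_rooted_tree_def flip: tg)
  moreover have "P.branch w = - cont_frac r m"
    using P.psi_theta_quotient[of ws] ws quot by (simp flip: tg)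
  ultimately interpret S: stalk_degrees_tree r m "pverts T" w par depth
    by unfold_locales
  obtain h where "inj_on h labels" "h (0, 0) = w" "T = caterpillar h"
    by (rule S.labelling_exists) (simp flip: tg)
  then show ?thesis using rooted_iso_caterpillar by metis
qed

lemma degree_of_caterpillar:
  "x \<in> labels \<Longrightarrow> degree_of (caterpillar prod_encode) (prod_encode x) = C.deg (prod_encode x)"
  using C.degree_of_tree_graph[of "prod_encode x"] by (simp add: tree_graph_caterpillar)

end

theorem theorem3p3:
  fixes r :: nat and m :: "nat \<Rightarrow> nat"
  assumes "2 \<le> r"
    and "\<And>i. 1 \<le> i \<Longrightarrow> i \<le> r - 1 \<Longrightarrow> 2 \<le> m i"
  shows "\<exists>(T :: nat pair_pre_digraph) v\<^sub>0.
    pendant_rooted_tree T v\<^sub>0 \<and>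
    (\<forall>vs. vertex_order T v\<^sub>0 vs \<longrightarrow>
       Fraction_Field.Fract (psi T vs) (theta T vs) = cont_frac r m) \<and>
    (\<forall>(T' :: 'a pair_pre_digraph) w\<^sub>0 ws.
       pendant_rooted_tree T' w\<^sub>0 \<longrightarrow> vertex_order T' w\<^sub>0 ws \<longrightarrow>
       Fraction_Field.Fract (psi T' ws) (theta T' ws) = cont_frac r m \<longrightarrow>
       rooted_iso T v\<^sub>0 T' w\<^sub>0) \<and>
    (\<exists>v :: nat \<Rightarrow> nat. v 0 = v\<^sub>0 \<and>
       caterpillar_with_stalk T (map v [0..<Suc r]) \<and>
       degree_of T (v 0) = 1 \<and> degree_of T (v r) = 1 \<and>
       (\<forall>i. 1 \<le> i \<longrightarrow> i \<le> r - 1 \<longrightarrow> degree_of T (v i) = m i))"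
proof -
  interpret stalk_degrees r m using assms by unfold_locales
  have deg: "degree_of (caterpillar prod_encode) (prod_encode (i, 0)) = C.deg (prod_encode (i, 0))"
    if "i \<le> r" for i
    using that by (intro degree_of_caterpillar stalk_in_labels)
  show ?thesis
  proof (intro exI[of _ "caterpillar prod_encode"] exI[of _ "prod_encode (0, 0)"] conjI allI impI
      exI[of _ "\<lambda>i. prod_encode (i, 0)"])
    show "degree_of (caterpillar prod_encode) (prod_encode (0, 0)) = 1"
      "degree_of (caterpillar prod_encode) (prod_encode (r, 0)) = 1"
      by (simp_all add: deg deg_root deg_end)
    show "degree_of (caterpillar prod_encode) (prod_encode (i, 0)) = m i"
      if "1 \<le> i" "i \<le> r - 1" for i
      using that deg[of i] deg_stalk[of i] by simp
  qed (rule pendant_rooted_tree_caterpillar caterpillar_quotient caterpillar_unique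
      caterpillar_with_stalk_caterpillar refl; assumption?)+
qed

end
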